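(* Consider, on a two-dimensional Cartesian mesh, the active flux method described in the context for $\partial_t U+\partial_x F_1(U)+\partial_y F_2(U)=0$ (a scalar conservation law or the compressible Euler equations), whose degrees of freedom are the cell averages $\overline U_{i,j}$ and the point values $U_\sigma$. If the initial numerical solution satisfies $\overline U^0_{i,j}\in\mathcal G$ and $U^0_\sigma\in\mathcal G$ for all $i,j,\sigma$, and the time step size satisfies the cell-average condition $$\Delta t^n\le\frac12\min\Big\{\frac{\Delta x_i}{(\alpha_1)_{i-\frac12,j}+(\alpha_1)_{i+\frac12,j}},\ \frac{\Delta y_j}{(\alpha_2)_{i,j-\frac12}+(\alpha_2)_{i,j+\frac12}}\Big\}$$ and the point-value condition $$\begin{aligned}\Delta t^n\le\frac12\min\Big\{&\frac{\Delta x_i+\Delta x_{i+1}}{2((\alpha_1)_{i,j+\frac12}+(\alpha_1)_{i+1,j+\frac12})},\ \frac{\Delta y_j+\Delta y_{j+1}}{2((\alpha_2)_{i+\frac12,j}+(\alpha_2)_{i+\frac12,j+1})},\\&\frac{\Delta x_i+\Delta x_{i+1}}{2((\alpha_1)_{i,j}+(\alpha_1)_{i+1,j})},\ \frac{\Delta y_j}{(\alpha_2)_{i+\frac12,j+\frac12}+(\alpha_2)_{i+\frac12,j-\frac12}},\\&\frac{\Delta x_i}{(\alpha_1)_{i+\frac12,j+\frac12}+(\alpha_1)_{i-\frac12,j+\frac12}},\ \frac{\Delta y_j+\Delta y_{j+1}}{2((\alpha_2)_{i,j}+(\alpha_2)_{i,j+1})}\Big\},\end{aligned}$$ then the active flux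 method, equipped with the SSP-RK3 time integration and the bound-preserving limitings of the context, has the following properties: (1) with the cell-average limiting (A-scalar) and the point-value limiting (P-scalar), it preserves the maximum principle in the scalar case (the cell averages and point values stay in $[m_0,M_0]$); (2) with the cell-average limiting (A-Euler) and the point-value limiting (P-Euler), it preserves the positivity of density and pressure for the Euler equations (the cell averages and point values stay in $\mathcal G$).
   Context: **Equations and admissible sets.** Scalar case: $U=u\in\mathbb R$, $F_\ell=f_\ell$, $\mathcal G=\{u: m_0\le u\le M_0\}$ with $m_0=\min u_0$, $M_0=\max u_0$, $u_0$ the initial datum. Euler case: $U=(\rho,\rho v_1,\rho v_2,E)$, $F_1=(\rho v_1,\rho v_1^2+p,\rho v_1v_2,(E+p)v_1)$, $F_2=(\rho v_2,\rho v_1v_2,\rho v_2^2+p,(E+p)v_2)$, $p=p(U)=(\gamma-1)\big(E-\frac{|\rho v|^2}{2\rho}\big)$, $\gamma>1$, $\mathcal G=\{U:\rho>0,\ p>0\}$. $\mathcal G$ is convex. $\varrho_\ell(U)$ is the spectral radius of $\partial F_\ell/\partial U$. For states $V,W$ put $\alpha_\ell(V,W)=\max\{\varrho_\ell(V),\varrho_\ell(W)\}$ and $\widehat F^{LLF}_\ell(V,W)=\frac12(F_\ell(V)+F_\ell(W))-\frac{\alpha_\ell(V,W)}2(W-V)$. Superscripts $\rho,\rho v,E$ denote the density, momentum and energy components of a vector. **Mesh and unknowns.** Cells $I_{i,j}=[x_{i-1/2},x_{i+1/2}]\times[y_{j-1/2},y_{j+1/2}]$ with sizes $\Delta x_i,\Delta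 y_j$; unknowns are the cell averages $\overline U_{i,j}$ and the point values $U_\sigma$, $\sigma\in\{(i+\frac12,j),(i,j+\frac12),(i+\frac12,j+\frac12)\}$ (face centers and nodes). **Semi-discrete method.** Cell averages: $\frac{d}{dt}\overline U_{i,j}=-\frac1{\Delta x_i}(\widehat F_{i+\frac12,j}-\widehat F_{i-\frac12,j})-\frac1{\Delta y_j}(\widehat F_{i,j+\frac12}-\widehat F_{i,j-\frac12})$. The high-order fluxes $\widehat F^H$ approximate the face averages of $F_1(U_h)$ and $F_2(U_h)$, $U_h$ being the numerical solution; for third order, Simpson's rule is used: $\widehat F^H_{i+\frac12,j}=\frac16\big(F_1(U_{i+\frac12,j-\frac12})+4F_1(U_{i+\frac12,j})+F_1(U_{i+\frac12,j+\frac12})\big)$, and analogously in $y$. Point values: $\frac{d}{dt}U_\sigma=-\mathcal R_\sigma$, where $\mathcal R_\sigma$ is a consistent approximation of $\partial_xF_1+\partial_yF_2$ at $\sigma$ computed from cell averages and point values in a stencil around $\sigma$. $U^H_\sigma$ denotes the result of a forward-Euler step of this point-value update. **SSP-RK3.** $U^*=U^n+\Delta t^nL(U^n)$, $U^{**}=\frac34U^n+\frac14(U^*+\Delta t^nL(U^* ))$, $U^{n+1}=\frac13U^n+\frac23(U^{**}+\Delta t^nL(U^{**}))$, with $L$ the right-hand side of the semi-discrete method; this is a convex combination of forward-Euler stages. The limitings are formulated below for a forward-Euler step starting from the data at time level $n$ (superscript $n$ omitted). **Cell-average limiting.** $(\alpha_1)_{i+\frac12,j}=\alpha_1(\overline U_{i,j},\overline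 U_{i+1,j})$, $\widehat F^L_{i+\frac12,j}=\widehat F^{LLF}_1(\overline U_{i,j},\overline U_{i+1,j})$, $\widetilde U_{i+\frac12,j}=\frac12(\overline U_{i,j}+\overline U_{i+1,j})+\frac1{2(\alpha_1)_{i+\frac12,j}}(F_1(\overline U_{i,j})-F_1(\overline U_{i+1,j}))$, $\Delta\widehat F_{i+\frac12,j}=\widehat F^H_{i+\frac12,j}-\widehat F^L_{i+\frac12,j}$; in $y$ analogously, with $(\alpha_2)_{i,j+\frac12}=\alpha_2(\overline U_{i,j},\overline U_{i,j+1})$. The limited fluxes replace $\widehat F^H$ in the cell-average update. Below, the index $(i+\frac12,j)$ is understood; the $y$-direction is analogous. (A-scalar) $\widehat f^{Lim}=\widehat f^L+\Delta\widehat f^{Lim}$, with $\Delta\widehat f^{Lim}=\min\{\Delta\widehat f,\Delta\widehat f^+\}$ if $\Delta\widehat f\ge0$ and $\max\{\Delta\widehat f,\Delta\widehat f^-\}$ otherwise, where $\Delta\widehat f^+=\alpha_1\min\{\widetilde u-u^{\min}_{i,j},\,u^{\max}_{i+1,j}-\widetilde u\}$ and $\Delta\widehat f^-=\alpha_1\max\{u^{\min}_{i+1,j}-\widetilde u,\,\widetilde u-u^{\max}_{i,j}\}$. The bounds are either global, $u^{\min}_{i,j}=m_0$, $u^{\max}_{i,j}=M_0$, or local, $u^{\min}_{i,j}=\min\{\overline u_{i,j},\widetilde u_{i-\frac12,j},\widetilde u_{i+\frac12,j}\}$ and $u^{\max}_{i,j}$ the corresponding maximum. (A-Euler) Let $\varepsilon>0$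 be a small threshold ($10^{-13}$ in practice). Step 1 (density): $\Delta\widehat F^{Lim,\rho}=\min\{\Delta\widehat F^\rho,\alpha_1(\widetilde U^\rho-\varepsilon)\}$ if $\Delta\widehat F^\rho\ge0$ and $\max\{\Delta\widehat F^\rho,\alpha_1(\varepsilon-\widetilde U^\rho)\}$ otherwise. Let $\widehat F^{Lim,*}$ have density component $\widehat F^{L,\rho}+\Delta\widehat F^{Lim,\rho}$ and the momentum and energy components of $\widehat F^H$; put $D=\widehat F^{Lim,*}-\widehat F^L$. Step 2 (pressure): with $A=\frac12|D^{\rho v}|^2-D^\rho D^E$, $B=\alpha_1(D^\rho\widetilde U^E+\widetilde U^\rho D^E-D^{\rho v}\cdot\widetilde U^{\rho v}-\varepsilon D^\rho)$ and $C=\alpha_1^2(\widetilde U^\rho\widetilde U^E-\frac12|\widetilde U^{\rho v}|^2-\varepsilon\widetilde U^\rho)$, set $\theta=\min\{1,\,C/(\max\{0,A\}+|B|)\}$. The limited flux is $\widehat F^{L}+\theta D$. **Point-value limiting.** Low-order (local Lax–Friedrichs) states, with $\Delta t=\Delta t^n$: node: $U^L_{i+\frac12,j+\frac12}=U_{i+\frac12,j+\frac12}-\frac{2\Delta t}{\Delta x_i+\Delta x_{i+1}}\big(\widehat F_1^{LLF}(U_{i+\frac12,j+\frac12},U_{i+\frac32,j+\frac12})-\widehat F_1^{LLF}(U_{i-\frac12,j+\frac12},U_{i+\frac12,j+\frac12})\big)-\frac{2\Delta t}{\Delta y_j+\Delta y_{j+1}}\big(\widehat F_2^{LLF}(U_{i+\frac12,j+\frac12},U_{i+\frac12,j+\frac32})-\widehat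 F_2^{LLF}(U_{i+\frac12,j-\frac12},U_{i+\frac12,j+\frac12})\big)$; vertical face: $U^L_{i+\frac12,j}=U_{i+\frac12,j}-\frac{2\Delta t}{\Delta x_i+\Delta x_{i+1}}\big(\widehat F_1^{LLF}(U_{i+\frac12,j},U_{i+\frac32,j})-\widehat F_1^{LLF}(U_{i-\frac12,j},U_{i+\frac12,j})\big)-\frac{\Delta t}{\Delta y_j}\big(\widehat F_2^{LLF}(U_{i+\frac12,j},U_{i+\frac12,j+\frac12})-\widehat F_2^{LLF}(U_{i+\frac12,j-\frac12},U_{i+\frac12,j})\big)$; horizontal face: $U^L_{i,j+\frac12}=U_{i,j+\frac12}-\frac{\Delta t}{\Delta x_i}\big(\widehat F_1^{LLF}(U_{i,j+\frac12},U_{i+\frac12,j+\frac12})-\widehat F_1^{LLF}(U_{i-\frac12,j+\frac12},U_{i,j+\frac12})\big)-\frac{2\Delta t}{\Delta y_j+\Delta y_{j+1}}\big(\widehat F_2^{LLF}(U_{i,j+\frac12},U_{i,j+\frac32})-\widehat F_2^{LLF}(U_{i,j-\frac12},U_{i,j+\frac12})\big)$. The coefficients in the point-value time-step condition are those of these LLF fluxes: for nodes, $(\alpha_1)_{i,j+\frac12}=\alpha_1(U_{i-\frac12,j+\frac12},U_{i+\frac12,j+\frac12})$ and $(\alpha_2)_{i+\frac12,j}=\alpha_2(U_{i+\frac12,j-\frac12},U_{i+\frac12,j+\frac12})$; for vertical faces, $(\alpha_1)_{i,j}=\alpha_1(U_{i-\frac12,j},U_{i+\frac12,j})$, $(\alpha_2)_{i+\frac12,j+\frac12}=\alpha_2(U_{i+\frac12,j},U_{i+\frac12,j+\frac12})$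 and $(\alpha_2)_{i+\frac12,j-\frac12}=\alpha_2(U_{i+\frac12,j-\frac12},U_{i+\frac12,j})$; for horizontal faces, $(\alpha_1)_{i+\frac12,j+\frac12}=\alpha_1(U_{i,j+\frac12},U_{i+\frac12,j+\frac12})$, $(\alpha_1)_{i-\frac12,j+\frac12}=\alpha_1(U_{i-\frac12,j+\frac12},U_{i,j+\frac12})$ and $(\alpha_2)_{i,j}=\alpha_2(U_{i,j-\frac12},U_{i,j+\frac12})$; the others by shifting $i$ or $j$ by one. (P-scalar) $u^{Lim}_\sigma=\theta_\sigma u^H_\sigma+(1-\theta_\sigma)u^L_\sigma$ with $\theta_\sigma=\min\Big\{\Big|\frac{u^L_\sigma-m_0}{u^L_\sigma-u^H_\sigma}\Big|,\Big|\frac{M_0-u^L_\sigma}{u^H_\sigma-u^L_\sigma}\Big|,1\Big\}$. (P-Euler) Step 1: $\theta^*_\sigma=\min\Big\{\frac{U^{L,\rho}_\sigma-\varepsilon}{U^{L,\rho}_\sigma-U^{H,\rho}_\sigma},1\Big\}$, obtained by requiring the limited density to exceed $\varepsilon$; $U^{Lim,*}_\sigma$ has density $\theta^*_\sigma U^{H,\rho}_\sigma+(1-\theta^*_\sigma)U^{L,\rho}_\sigma$ and the momentum and energy of $U^H_\sigma$. Step 2: $U^{Lim}_\sigma=\theta^{**}_\sigma U^{Lim,*}_\sigma+(1-\theta^{**}_\sigma)U^L_\sigma$ with $\theta^{**}_\sigma\in[0,1]$ given by $\theta^{**}_\sigma=\min\Big\{\frac{p(U^L_\sigma)-\varepsilon}{p(U^L_\sigma)-p(U^{Lim,*}_\sigma)},1\Big\}$,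 obtained by requiring $p(U^{Lim}_\sigma)>\varepsilon$.
   Formalization: Added: scalar fluxes are differentiable with |f'| between two states of [m0,M0] at most its end-point maximum (fails e.g. for sin); epsilon is at most density and pressure (p/(gamma-1) for U-tilde) of low-order states; time-step conditions hold at each RK stage's data. *)

theory Defs
  imports "HOL-Analysis.Analysis"
begin

section \<open>Fluxes, wave speeds and the local Lax--Friedrichs flux\<close>

text \<open>
  Spectral radius of a real-linear endomorphism \<open>L\<close>: the supremum of \<open>\<bar>z\<bar>\<close> over the complex
  eigenvalues \<open>z\<close> of \<open>L\<close>. The two equations are the real and imaginary part of
  \<open>L (p + \<i> q) = z (p + \<i> q)\<close> in the complexified space.
\<close>

definition spectral_radius :: "('a::real_vector \<Rightarrow> 'a) \<Rightarrow> real" where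
  "spectral_radius L = Sup {cmod z | z. \<exists>p q. (p \<noteq> 0 \<or> q \<noteq> 0) \<and>
      L p = Re z *\<^sub>R p - Im z *\<^sub>R q \<and> L q = Im z *\<^sub>R p + Re z *\<^sub>R q}"

definition wave_speed :: "('a::euclidean_space \<Rightarrow> 'a) \<Rightarrow> 'a \<Rightarrow> real" where
  "wave_speed F U = spectral_radius (frechet_derivative F (at U))"

definition alpha :: "('a::euclidean_space \<Rightarrow> 'a) \<Rightarrow> 'a \<Rightarrow> 'a \<Rightarrow> real" where
  "alpha F V W = max (wave_speed F V) (wave_speed F W)"

definition llf :: "('a::euclidean_space \<Rightarrow> 'a) \<Rightarrow> 'a \<Rightarrow> 'a \<Rightarrow> 'a" where
  "llf F V W = (1/2) *\<^sub>R (F V + F W) - (alpha F V W / 2) *\<^sub>R (W - V)"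

text \<open>
  The intermediate state \<open>\<widetilde>U\<close>. Where \<open>alpha F V W = 0\<close>, division by zero makes it the
  arithmetic mean; under the hypotheses of the theorem, \<open>F V = F W\<close> in that case.
\<close>

definition mid :: "('a::euclidean_space \<Rightarrow> 'a) \<Rightarrow> 'a \<Rightarrow> 'a \<Rightarrow> 'a" where
  "mid F V W = (1/2) *\<^sub>R (V + W) + (1 / (2 * alpha F V W)) *\<^sub>R (F V - F W)"


section \<open>Mesh and degrees of freedom\<close>

text \<open>
  The mesh is given by its grid lines: \<open>x i\<close> stands for $x_{i+1/2}$ and \<open>y j\<close> for $y_{j+1/2}$.
  Half-integer positions are encoded by the cell to their lower left: \<open>VFace i j\<close> is the point
  $(i+1/2,j)$, \<open>HFace i j\<close> is $(i,j+1/2)$ and \<open>Node i j\<close> is $(i+1/2,j+1/2)$; likewise a flux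
  with index \<open>i j\<close> sits on the face $(i+1/2,j)$ in the first and $(i,j+1/2)$ in the second
  direction.
\<close>

definition width :: "(int \<Rightarrow> real) \<Rightarrow> int \<Rightarrow> real" where
  "width x i = x i - x (i - 1)"

definition cell :: "(int \<Rightarrow> real) \<Rightarrow> (int \<Rightarrow> real) \<Rightarrow> int \<Rightarrow> int \<Rightarrow> (real \<times> real) set" where
  "cell x y i j = {x (i - 1)..x i} \<times> {y (j - 1)..y j}"

definition mesh_domain :: "(int \<Rightarrow> real) \<Rightarrow> (int \<Rightarrow> real) \<Rightarrow> (real \<times> real) set" where
  "mesh_domain x y = (\<Union>i j. cell x y i j)"

datatype pt = VFace int int | HFace int int | Node int int

record 'a af =
  avg :: "int \<Rightarrow> int \<Rightarrow> 'a"
  pv :: "pt \<Rightarrow> 'a"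

definition dofs_in :: "'a set \<Rightarrow> 'a af \<Rightarrow> bool" where
  "dofs_in G U \<longleftrightarrow> (\<forall>i j. avg U i j \<in> G) \<and> (\<forall>\<sigma>. pv U \<sigma> \<in> G)"


section \<open>Limited forward-Euler stage and SSP-RK3\<close>

fun pv_low :: "(int \<Rightarrow> real) \<Rightarrow> (int \<Rightarrow> real) \<Rightarrow> ('a::euclidean_space \<Rightarrow> 'a) \<Rightarrow> ('a \<Rightarrow> 'a) \<Rightarrow>
    real \<Rightarrow> 'a af \<Rightarrow> pt \<Rightarrow> 'a" where
  "pv_low x y F1 F2 dt U (Node i j) = (let u = (\<lambda>i j. pv U (Node i j)) in
     u i j
     - (2 * dt / (width x i + width x (i+1))) *\<^sub>R
         (llf F1 (u i j) (u (i+1) j) - llf F1 (u (i-1) j) (u i j))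
     - (2 * dt / (width y j + width y (j+1))) *\<^sub>R
         (llf F2 (u i j) (u i (j+1)) - llf F2 (u i (j-1)) (u i j)))"
| "pv_low x y F1 F2 dt U (VFace i j) =
     (let u = (\<lambda>i j. pv U (VFace i j)); w = (\<lambda>i j. pv U (Node i j)) in
     u i j
     - (2 * dt / (width x i + width x (i+1))) *\<^sub>R
         (llf F1 (u i j) (u (i+1) j) - llf F1 (u (i-1) j) (u i j))
     - (dt / width y j) *\<^sub>R
         (llf F2 (u i j) (w i j) - llf F2 (w i (j-1)) (u i j)))"
| "pv_low x y F1 F2 dt U (HFace i j) =
     (let u = (\<lambda>i j. pv U (HFace i j)); w = (\<lambda>i j. pv U (Node i j)) in
     u i j
     - (dt / width x i) *\<^sub>R
         (llf F1 (u i j) (w i j) - llf F1 (w (i-1) j) (u i j))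
     - (2 * dt / (width y j + width y (j+1))) *\<^sub>R
         (llf F2 (u i j) (u i (j+1)) - llf F2 (u i (j-1)) (u i j)))"

text \<open>
  One limited forward-Euler stage. \<open>FH1\<close> and \<open>FH2\<close> are the high-order fluxes (for instance
  Simpson's rule applied to \<open>F1\<close>, \<open>F2\<close> at the three point values of a face) and \<open>R\<close> is the
  point-value residual; all three are arbitrary functions of the degrees of freedom.
  The flux limiters \<open>lim1\<close>, \<open>lim2\<close> act along a mesh line: \<open>lim w FH k\<close> is the limited
  flux between the cells \<open>k\<close> and \<open>k + 1\<close> of a line with cell averages \<open>w\<close>, where \<open>FH\<close> is the
  high-order flux there. The point-value limiter maps a low-order and a high-order state to
  the limited one.
\<close>

definition limited_stage ::
  "(int \<Rightarrow> real) \<Rightarrow> (int \<Rightarrow> real) \<Rightarrow> ('a::euclidean_space \<Rightarrow> 'a) \<Rightarrow> ('a \<Rightarrow> 'a) \<Rightarrow>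
   ('a af \<Rightarrow> int \<Rightarrow> int \<Rightarrow> 'a) \<Rightarrow> ('a af \<Rightarrow> int \<Rightarrow> int \<Rightarrow> 'a) \<Rightarrow> ('a af \<Rightarrow> pt \<Rightarrow> 'a) \<Rightarrow>
   ((int \<Rightarrow> 'a) \<Rightarrow> 'a \<Rightarrow> int \<Rightarrow> 'a) \<Rightarrow> ((int \<Rightarrow> 'a) \<Rightarrow> 'a \<Rightarrow> int \<Rightarrow> 'a) \<Rightarrow> ('a \<Rightarrow> 'a \<Rightarrow> 'a) \<Rightarrow>
   real \<Rightarrow> 'a af \<Rightarrow> 'a af" where
  "limited_stage x y F1 F2 FH1 FH2 R lim1 lim2 plim dt U =
    (let G1 = (\<lambda>i j. lim1 (\<lambda>k. avg U k j) (FH1 U i j) i);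
         G2 = (\<lambda>i j. lim2 (\<lambda>k. avg U i k) (FH2 U i j) j)
     in \<lparr> avg = (\<lambda>i j. avg U i j - (dt / width x i) *\<^sub>R (G1 i j - G1 (i-1) j)
                             - (dt / width y j) *\<^sub>R (G2 i j - G2 i (j-1))),
          pv = (\<lambda>\<sigma>. plim (pv_low x y F1 F2 dt U \<sigma>) (pv U \<sigma> - dt *\<^sub>R R U \<sigma>)) \<rparr>)"

definition combine :: "real \<Rightarrow> 'a::real_vector af \<Rightarrow> real \<Rightarrow> 'a af \<Rightarrow> 'a af" where
  "combine a U b W = \<lparr> avg = (\<lambda>i j. a *\<^sub>R avg U i j + b *\<^sub>R avg W i j),
                       pv = (\<lambda>\<sigma>. a *\<^sub>R pv U \<sigma> + b *\<^sub>R pv W \<sigma>) \<rparr>"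

definition rk_stage2 :: "('a::real_vector af \<Rightarrow> 'a af) \<Rightarrow> 'a af \<Rightarrow> 'a af" where
  "rk_stage2 S U = combine (3/4) U (1/4) (S (S U))"

definition ssp_rk3 :: "('a::real_vector af \<Rightarrow> 'a af) \<Rightarrow> 'a af \<Rightarrow> 'a af" where
  "ssp_rk3 S U = combine (1/3) U (2/3) (S (rk_stage2 S U))"

text \<open>The three states from which the forward-Euler stages of one SSP-RK3 step start.\<close>

definition rk_stages :: "('a::real_vector af \<Rightarrow> 'a af) \<Rightarrow> 'a af \<Rightarrow> 'a af set" where
  "rk_stages S U = {U, S U, rk_stage2 S U}"


section \<open>Time-step conditions\<close>

text \<open>
  The quotients are taken in the extended reals, where a positive number divided by zero is
  \<open>\<infinity>\<close>: a vanishing wave speed imposes no restriction on the time step.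
\<close>

definition cfl_avg :: "(int \<Rightarrow> real) \<Rightarrow> (int \<Rightarrow> real) \<Rightarrow> ('a::euclidean_space \<Rightarrow> 'a) \<Rightarrow>
    ('a \<Rightarrow> 'a) \<Rightarrow> real \<Rightarrow> 'a af \<Rightarrow> bool" where
  "cfl_avg x y F1 F2 dt U \<longleftrightarrow>
    (let a1 = (\<lambda>i j. alpha F1 (avg U i j) (avg U (i+1) j));
         a2 = (\<lambda>i j. alpha F2 (avg U i j) (avg U i (j+1)))
     in \<forall>i j. ereal dt \<le> 1/2 * min
          (ereal (width x i) / ereal (a1 (i-1) j + a1 i j))
          (ereal (width y j) / ereal (a2 i (j-1) + a2 i j)))"

text \<open>
  Below, \<open>n1\<close>, \<open>n2\<close> are the coefficients of the node fluxes, with \<open>n1 i j\<close> at $(i,j+1/2)$ and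
  \<open>n2 i j\<close> at $(i+1/2,j)$; \<open>v1\<close> (at $(i,j)$), \<open>v2p\<close> and \<open>v2m\<close> (at $(i+1/2,j+1/2)$
  and $(i+1/2,j-1/2)$) are those of the vertical faces; \<open>h1p\<close>, \<open>h1m\<close> (at $(i+1/2,j+1/2)$ and
  $(i-1/2,j+1/2)$) and \<open>h2\<close> (at $(i,j)$) are those of the horizontal faces.
\<close>

definition cfl_pv :: "(int \<Rightarrow> real) \<Rightarrow> (int \<Rightarrow> real) \<Rightarrow> ('a::euclidean_space \<Rightarrow> 'a) \<Rightarrow>
    ('a \<Rightarrow> 'a) \<Rightarrow> real \<Rightarrow> 'a af \<Rightarrow> bool" where
  "cfl_pv x y F1 F2 dt U \<longleftrightarrow>
    (let n = (\<lambda>i j. pv U (Node i j));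
         v = (\<lambda>i j. pv U (VFace i j));
         h = (\<lambda>i j. pv U (HFace i j));
         n1 = (\<lambda>i j. alpha F1 (n (i-1) j) (n i j));
         n2 = (\<lambda>i j. alpha F2 (n i (j-1)) (n i j));
         v1 = (\<lambda>i j. alpha F1 (v (i-1) j) (v i j));
         v2p = (\<lambda>i j. alpha F2 (v i j) (n i j));
         v2m = (\<lambda>i j. alpha F2 (n i (j-1)) (v i j));
         h1p = (\<lambda>i j. alpha F1 (h i j) (n i j));
         h1m = (\<lambda>i j. alpha F1 (n (i-1) j) (h i j));
         h2 = (\<lambda>i j. alpha F2 (h i (j-1)) (h i j))
     in \<forall>i j. ereal dt \<le> 1/2 * Min
          {ereal (width x i + width x (i+1)) / ereal (2 * (n1 i j + n1 (i+1) j)),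
           ereal (width y j + width y (j+1)) / ereal (2 * (n2 i j + n2 i (j+1))),
           ereal (width x i + width x (i+1)) / ereal (2 * (v1 i j + v1 (i+1) j)),
           ereal (width y j) / ereal (v2p i j + v2m i j),
           ereal (width x i) / ereal (h1p i j + h1m i j),
           ereal (width y j + width y (j+1)) / ereal (2 * (h2 i j + h2 i (j+1)))})"


section \<open>Limitings for scalar conservation laws\<close>

datatype bound_choice = Global_Bounds | Local_Bounds

fun bound_min :: "bound_choice \<Rightarrow> real \<Rightarrow> (real \<Rightarrow> real) \<Rightarrow> (int \<Rightarrow> real) \<Rightarrow> int \<Rightarrow> real" where
  "bound_min Global_Bounds m0 f w k = m0"
| "bound_min Local_Bounds m0 f w k =
     Min {w k, mid f (w (k-1)) (w k), mid f (w k) (w (k+1))}"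

fun bound_max :: "bound_choice \<Rightarrow> real \<Rightarrow> (real \<Rightarrow> real) \<Rightarrow> (int \<Rightarrow> real) \<Rightarrow> int \<Rightarrow> real" where
  "bound_max Global_Bounds M0 f w k = M0"
| "bound_max Local_Bounds M0 f w k =
     Max {w k, mid f (w (k-1)) (w k), mid f (w k) (w (k+1))}"

definition scalar_flux_lim :: "bound_choice \<Rightarrow> real \<Rightarrow> real \<Rightarrow> (real \<Rightarrow> real) \<Rightarrow>
    (int \<Rightarrow> real) \<Rightarrow> real \<Rightarrow> int \<Rightarrow> real" where
  "scalar_flux_lim b m0 M0 f w fH k =
    (let a = alpha f (w k) (w (k+1));
         ut = mid f (w k) (w (k+1));
         fL = llf f (w k) (w (k+1));
         d = fH - fL;
         dp = a * min (ut - bound_min b m0 f w k) (bound_max b M0 f w (k+1) - ut);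
         dm = a * max (bound_min b m0 f w (k+1) - ut) (ut - bound_max b M0 f w k)
     in fL + (if d \<ge> 0 then min d dp else max d dm))"

text \<open>If \<open>uL = uH\<close>, the value of \<open>\<theta>\<close> does not matter.\<close>

definition scalar_pv_lim :: "real \<Rightarrow> real \<Rightarrow> real \<Rightarrow> real \<Rightarrow> real" where
  "scalar_pv_lim m0 M0 uL uH =
    (let \<theta> = Min {\<bar>(uL - m0) / (uL - uH)\<bar>, \<bar>(M0 - uL) / (uH - uL)\<bar>, 1}
     in \<theta> * uH + (1 - \<theta>) * uL)"

definition scalar_stage ::
  "bound_choice \<Rightarrow> real \<Rightarrow> real \<Rightarrow> (int \<Rightarrow> real) \<Rightarrow> (int \<Rightarrow> real) \<Rightarrow>
   (real \<Rightarrow> real) \<Rightarrow> (real \<Rightarrow> real) \<Rightarrow>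
   (real af \<Rightarrow> int \<Rightarrow> int \<Rightarrow> real) \<Rightarrow> (real af \<Rightarrow> int \<Rightarrow> int \<Rightarrow> real) \<Rightarrow> (real af \<Rightarrow> pt \<Rightarrow> real) \<Rightarrow>
   real \<Rightarrow> real af \<Rightarrow> real af" where
  "scalar_stage b m0 M0 x y f1 f2 fH1 fH2 R =
    limited_stage x y f1 f2 fH1 fH2 R
      (scalar_flux_lim b m0 M0 f1) (scalar_flux_lim b m0 M0 f2) (scalar_pv_lim m0 M0)"

text \<open>
  For \<open>alpha\<close> to be the largest wave speed between two states, as the local Lax--Friedrichs
  flux needs, the wave speed over any subinterval of \<open>G\<close> must be largest at an end point (as
  it is for convex and concave fluxes, for example). Otherwise the scheme can leave the bounds:
  for \<open>f = sin\<close> and the states \<open>\<plusminus>\<pi>/2\<close>, \<open>alpha\<close> vanishes although the fluxes differ.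
\<close>

definition admissible_flux :: "real set \<Rightarrow> (real \<Rightarrow> real) \<Rightarrow> bool" where
  "admissible_flux G f \<longleftrightarrow> (\<forall>u\<in>G. f differentiable at u) \<and>
     (\<forall>V\<in>G. \<forall>W\<in>G. \<forall>u\<in>closed_segment V W. wave_speed f u \<le> alpha f V W)"


section \<open>Compressible Euler equations\<close>

text \<open>States are triples of density, momentum and total energy.\<close>

type_synonym euler_state = "real \<times> (real \<times> real) \<times> real"

abbreviation dens :: "euler_state \<Rightarrow> real" where "dens U \<equiv> fst U"
abbreviation mom :: "euler_state \<Rightarrow> real \<times> real" where "mom U \<equiv> fst (snd U)"
abbreviation energy :: "euler_state \<Rightarrow> real" where "energy U \<equiv> snd (snd U)"

definition pressure :: "real \<Rightarrow> euler_state \<Rightarrow> real" where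
  "pressure \<gamma> U = (\<gamma> - 1) * (energy U - (norm (mom U))\<^sup>2 / (2 * dens U))"

definition velocity :: "euler_state \<Rightarrow> real \<times> real" where
  "velocity U = (1 / dens U) *\<^sub>R mom U"

definition euler_flux1 :: "real \<Rightarrow> euler_state \<Rightarrow> euler_state" where
  "euler_flux1 \<gamma> U = (let r = dens U; v1 = fst (velocity U); v2 = snd (velocity U);
       p = pressure \<gamma> U in
     (r * v1, (r * v1\<^sup>2 + p, r * v1 * v2), (energy U + p) * v1))"

definition euler_flux2 :: "real \<Rightarrow> euler_state \<Rightarrow> euler_state" where
  "euler_flux2 \<gamma> U = (let r = dens U; v1 = fst (velocity U); v2 = snd (velocity U);
       p = pressure \<gamma> U in
     (r * v2, (r * v1 * v2, r * v2\<^sup>2 + p), (energy U + p) * v2))"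

definition euler_G :: "real \<Rightarrow> euler_state set" where
  "euler_G \<gamma> = {U. dens U > 0 \<and> pressure \<gamma> U > 0}"

text \<open>
  A vanishing denominator means that the pressure constraint does not restrict \<open>\<theta>\<close>.
\<close>

definition euler_flux_lim :: "real \<Rightarrow> (euler_state \<Rightarrow> euler_state) \<Rightarrow>
    (int \<Rightarrow> euler_state) \<Rightarrow> euler_state \<Rightarrow> int \<Rightarrow> euler_state" where
  "euler_flux_lim \<epsilon> F w FH k =
    (let a = alpha F (w k) (w (k+1));
         Ut = mid F (w k) (w (k+1));
         FL = llf F (w k) (w (k+1));
         d = dens (FH - FL);
         dr = (if d \<ge> 0 then min d (a * (dens Ut - \<epsilon>)) else max d (a * (\<epsilon> - dens Ut)));
         D = (dens FL + dr, mom FH, energy FH) - FL;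
         A = (norm (mom D))\<^sup>2 / 2 - dens D * energy D;
         B = a * (dens D * energy Ut + dens Ut * energy D - mom D \<bullet> mom Ut - \<epsilon> * dens D);
         C = a\<^sup>2 * (dens Ut * energy Ut - (norm (mom Ut))\<^sup>2 / 2 - \<epsilon> * dens Ut);
         N = max 0 A + \<bar>B\<bar>;
         \<theta> = (if N = 0 then 1 else min 1 (C / N))
     in FL + \<theta> *\<^sub>R D)"

text \<open>
  \<open>blend_factor \<epsilon> qL qH\<close> is the largest \<open>\<theta>\<close> in \<open>[0, 1]\<close> with
  \<open>\<epsilon> \<le> (1 - \<theta>) * qL + \<theta> * qH\<close>, for \<open>\<epsilon> \<le> qL\<close>; where \<open>qH \<ge> qL\<close>, this is no
  restriction, and the quotient would be negative or undefined.
\<close>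

definition blend_factor :: "real \<Rightarrow> real \<Rightarrow> real \<Rightarrow> real" where
  "blend_factor \<epsilon> qL qH = (if qH < qL then min ((qL - \<epsilon>) / (qL - qH)) 1 else 1)"

definition euler_pv_lim :: "real \<Rightarrow> real \<Rightarrow> euler_state \<Rightarrow> euler_state \<Rightarrow> euler_state" where
  "euler_pv_lim \<gamma> \<epsilon> UL UH =
    (let \<theta>1 = blend_factor \<epsilon> (dens UL) (dens UH);
         Us = (\<theta>1 * dens UH + (1 - \<theta>1) * dens UL, mom UH, energy UH);
         \<theta>2 = blend_factor \<epsilon> (pressure \<gamma> UL) (pressure \<gamma> Us)
     in \<theta>2 *\<^sub>R Us + (1 - \<theta>2) *\<^sub>R UL)"

definition euler_stage ::
  "real \<Rightarrow> real \<Rightarrow> (int \<Rightarrow> real) \<Rightarrow> (int \<Rightarrow> real) \<Rightarrow>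
   (euler_state af \<Rightarrow> int \<Rightarrow> int \<Rightarrow> euler_state) \<Rightarrow> (euler_state af \<Rightarrow> int \<Rightarrow> int \<Rightarrow> euler_state) \<Rightarrow>
   (euler_state af \<Rightarrow> pt \<Rightarrow> euler_state) \<Rightarrow> real \<Rightarrow> euler_state af \<Rightarrow> euler_state af" where
  "euler_stage \<gamma> \<epsilon> x y FH1 FH2 R =
    limited_stage x y (euler_flux1 \<gamma>) (euler_flux2 \<gamma>) FH1 FH2 R
      (euler_flux_lim \<epsilon> (euler_flux1 \<gamma>)) (euler_flux_lim \<epsilon> (euler_flux2 \<gamma>)) (euler_pv_lim \<gamma> \<epsilon>)"

text \<open>
  Smallness of the threshold \<open>\<epsilon>\<close> in a stage starting from \<open>U\<close>: the low-order states, as far as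
  they have positive density and pressure, respect the threshold. That they do have positive
  density and pressure is not assumed here. For the cell averages the threshold acts on
  \<open>p / (\<gamma> - 1)\<close> instead of \<open>p\<close>, because \<open>C = \<alpha>\<^sup>2 \<rho> (p / (\<gamma> - 1) - \<epsilon>)\<close>
  in the flux limiter.
\<close>

definition small_threshold :: "real \<Rightarrow> real \<Rightarrow> (int \<Rightarrow> real) \<Rightarrow> (int \<Rightarrow> real) \<Rightarrow>
    real \<Rightarrow> euler_state af \<Rightarrow> bool" where
  "small_threshold \<gamma> \<epsilon> x y dt U \<longleftrightarrow>
    (\<forall>i j. \<forall>S \<in> {mid (euler_flux1 \<gamma>) (avg U i j) (avg U (i+1) j),
                  mid (euler_flux2 \<gamma>) (avg U i j) (avg U i (j+1))}.
       S \<in> euler_G \<gamma> \<longrightarrow> \<epsilon> \<le> dens S \<and> \<epsilon> \<le> pressure \<gamma> S / (\<gamma> - 1)) \<and>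
    (\<forall>\<sigma>. let S = pv_low x y (euler_flux1 \<gamma>) (euler_flux2 \<gamma>) dt U \<sigma> in
       S \<in> euler_G \<gamma> \<longrightarrow> \<epsilon> \<le> dens S \<and> \<epsilon> \<le> pressure \<gamma> S)"

end

theory Submission
  imports Defs
begin

text \<open>
  Each limited numerical flux between \<open>V\<close> and \<open>W\<close> can be written as
  \<open>F V + a *\<^sub>R (V - P) = F W + a *\<^sub>R (Q - W)\<close> with \<open>P\<close>, \<open>Q\<close> in the convex set \<open>G\<close> and the
  wave speed \<open>a\<close> of the time-step condition. A conservative update is then a convex combination
  of the old state and such intermediate states, and SSP-RK3 is a convex combination of forward
  Euler stages. For the unlimited Lax--Friedrichs flux, \<open>P = Q = mid F V W\<close>. This state lies in
  \<open>G\<close> by the mean value theorem for scalar fluxes; for the Euler equations it is the average of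
  \<open>V + F V / a\<close> and \<open>W - F W / a\<close>, which are in \<open>G\<close> as \<open>a \<ge> \<bar>v\<bar> + c\<close> with the sound speed
  \<open>c\<close>. The limiters are made so that adding the limited correction keeps \<open>P\<close> and \<open>Q\<close> in \<open>G\<close>.
\<close>


section \<open>Numerical fluxes as splittings\<close>

text \<open>Each side has its own state: \<open>P\<close> enters the update of \<open>V\<close>,
  \<open>Q\<close> that of \<open>W\<close>. They differ once a correction is added to the
  Lax-Friedrichs flux.\<close>

definition split_flux ::
  "'a::real_vector set \<Rightarrow> ('a \<Rightarrow> 'a) \<Rightarrow> real \<Rightarrow> 'a \<Rightarrow> 'a \<Rightarrow> 'a \<Rightarrow> bool" where
  "split_flux G F a V W g \<longleftrightarrow> 0 \<le> a \<and>
     (\<exists>P\<in>G. g = F V + a *\<^sub>R (V - P)) \<and> (\<exists>Q\<in>G. g = F W + a *\<^sub>R (Q - W))"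

text \<open>The last clause covers vanishing diffusion: there \<open>mid\<close> is just the
  arithmetic mean and carries no information on \<open>F V - F W\<close>.\<close>

definition llf_admissible :: "'a::euclidean_space set \<Rightarrow> ('a \<Rightarrow> 'a) \<Rightarrow> bool" where
  "llf_admissible G F \<longleftrightarrow> (\<forall>V\<in>G. \<forall>W\<in>G. 0 \<le> alpha F V W \<and> mid F V W \<in> G \<and>
     (alpha F V W = 0 \<longrightarrow> F V = F W))"

lemma llf_eq_left:
  assumes "alpha F V W = 0 \<Longrightarrow> F V = F W"
  shows "llf F V W = F V + alpha F V W *\<^sub>R (V - mid F V W)"
proof (cases "alpha F V W = 0")
  case True
  with assms show ?thesis by (simp add: llf_def flip: scaleR_2)
next
  case False
  let ?a = "alpha F V W"
  have m: "?a *\<^sub>R mid F V W =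
      (?a / 2) *\<^sub>R V + (?a / 2) *\<^sub>R W + (1/2) *\<^sub>R F V - (1/2) *\<^sub>R F W"
    using False by (simp add: mid_def scaleR_right_distrib scaleR_right_diff_distrib)
  have half: "?a *\<^sub>R V = (?a / 2) *\<^sub>R V + (?a / 2) *\<^sub>R V" "F V = (1/2) *\<^sub>R F V + (1/2) *\<^sub>R F V"
    by (simp_all flip: scaleR_left_distrib)
  have "F V + ?a *\<^sub>R (V - mid F V W) = F V + (?a *\<^sub>R V - ?a *\<^sub>R mid F V W)"
    by (simp only: scaleR_right_diff_distrib)
  also have "\<dots> = llf F V W"
    unfolding m llf_def by (subst half(1), subst half(2))
      (simp add: scaleR_right_distrib scaleR_right_diff_distrib)
  finally show ?thesis ..
qed

lemma llf_eq_right: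
  assumes "alpha F V W = 0 \<Longrightarrow> F V = F W"
  shows "llf F V W = F W + alpha F V W *\<^sub>R (mid F V W - W)"
proof (cases "alpha F V W = 0")
  case True
  with assms show ?thesis by (simp add: llf_def flip: scaleR_2)
next
  case False
  let ?a = "alpha F V W"
  have m: "?a *\<^sub>R mid F V W =
      (?a / 2) *\<^sub>R V + (?a / 2) *\<^sub>R W + (1/2) *\<^sub>R F V - (1/2) *\<^sub>R F W"
    using False by (simp add: mid_def scaleR_right_distrib scaleR_right_diff_distrib)
  have half: "?a *\<^sub>R W = (?a / 2) *\<^sub>R W + (?a / 2) *\<^sub>R W" "F W = (1/2) *\<^sub>R F W + (1/2) *\<^sub>R F W"
    by (simp_all flip: scaleR_left_distrib)
  have "F W + ?a *\<^sub>R (mid F V W - W) = F W + (?a *\<^sub>R mid F V W - ?a *\<^sub>R W)"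
    by (simp only: scaleR_right_diff_distrib)
  also have "\<dots> = llf F V W"
    unfolding m llf_def by (subst half(1), subst half(2))
      (simp add: scaleR_right_distrib scaleR_right_diff_distrib)
  finally show ?thesis ..
qed

text \<open>A correction \<open>d\<close> acts with opposite signs on the two sides:
  \<open>P = mid - d / a\<close> and \<open>Q = mid + d / a\<close>. Without diffusion nothing can
  absorb \<open>d\<close>, so it must vanish.\<close>

lemma split_flux_corrected_llf:
  assumes "llf_admissible G F" "V \<in> G" "W \<in> G"
    and "alpha F V W = 0 \<Longrightarrow> d = 0"
    and "alpha F V W > 0 \<Longrightarrow> mid F V W - (1 / alpha F V W) *\<^sub>R d \<in> G"
    and "alpha F V W > 0 \<Longrightarrow> mid F V W + (1 / alpha F V W) *\<^sub>R d \<in> G"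
  shows "split_flux G F (alpha F V W) V W (llf F V W + d)"
proof -
  let ?a = "alpha F V W" and ?m = "mid F V W"
  have a: "0 \<le> ?a" and m: "?m \<in> G" and eq: "?a = 0 \<Longrightarrow> F V = F W"
    using assms(1-3) by (auto simp: llf_admissible_def)
  show ?thesis
  proof (cases "?a = 0")
    case True
    then show ?thesis
      using assms(4) m eq llf_eq_left[of F V W, OF eq] by (auto simp: split_flux_def)
  next
    case False
    then have "llf F V W + d = F V + ?a *\<^sub>R (V - (?m - (1 / ?a) *\<^sub>R d))"
      "llf F V W + d = F W + ?a *\<^sub>R ((?m + (1 / ?a) *\<^sub>R d) - W)"
      using llf_eq_left[of F V W, OF eq] llf_eq_right[of F V W, OF eq]
      by (simp only: scaleR_diff_right scaleR_add_right; simp)+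
    then show ?thesis
      using False a assms(5,6) unfolding split_flux_def by (metis less_le)
  qed
qed

lemma split_flux_llf:
  assumes "llf_admissible G F" "V \<in> G" "W \<in> G"
  shows "split_flux G F (alpha F V W) V W (llf F V W)"
  using split_flux_corrected_llf[OF assms, of 0] assms by (simp add: llf_admissible_def)

lemma convex_combination3:
  assumes "convex G" "U \<in> G" "P \<in> G" "Q \<in> G" "0 \<le> a" "0 \<le> b" "0 \<le> c" "a + b + c = 1"
  shows "a *\<^sub>R U + b *\<^sub>R P + c *\<^sub>R Q \<in> G"
proof -
  have "a *\<^sub>R U + b *\<^sub>R P + c *\<^sub>R Q \<in> convex hull {U, P, Q}"
    using assms unfolding convex_hull_3 by blast
  then show ?thesis
    using hull_minimal[of "{U, P, Q}" G convex] assms by auto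
qed

text \<open>Both fluxes are expanded about the same \<open>F U\<close>, which cancels. What remains
  combines \<open>U\<close>, \<open>P\<close>, \<open>Q\<close> with weights
  \<open>1 - l * (aL + aR)\<close>, \<open>l * aR\<close>, \<open>l * aL\<close>.\<close>

lemma convex_update_1d:
  assumes "convex G" "U \<in> G" "0 \<le> l" "l * (aL + aR) \<le> 1"
    and "split_flux G F aR U W gR" "split_flux G F aL V U gL"
  shows "U - l *\<^sub>R (gR - gL) \<in> G"
proof -
  obtain P where P: "P \<in> G" "gR = F U + aR *\<^sub>R (U - P)" and "0 \<le> aR"
    using assms(5) by (auto simp: split_flux_def)
  obtain Q where Q: "Q \<in> G" "gL = F U + aL *\<^sub>R (Q - U)" and "0 \<le> aL"
    using assms(6) by (auto simp: split_flux_def)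
  have "U - l *\<^sub>R (gR - gL) =
      (1 - l * (aL + aR)) *\<^sub>R U + (l * aR) *\<^sub>R P + (l * aL) *\<^sub>R Q"
    unfolding P Q by (simp add: algebra_simps)
  also have "\<dots> \<in> G"
    using assms(1-4) P(1) Q(1) \<open>0 \<le> aL\<close> \<open>0 \<le> aR\<close>
    by (intro convex_combination3) (auto simp: algebra_simps)
  finally show ?thesis .
qed

text \<open>The average of two one-dimensional updates with doubled ratios; this doubling is the
  factor 1/2 in the time-step conditions.\<close>

lemma convex_update_2d:
  assumes "convex G" "U \<in> G" "0 \<le> l1" "0 \<le> l2"
    and "2 * l1 * (aL + aR) \<le> 1" "2 * l2 * (bL + bR) \<le> 1"
    and "split_flux G F1 aR U W1 gR" "split_flux G F1 aL V1 U gL"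
    and "split_flux G F2 bR U W2 hR" "split_flux G F2 bL V2 U hL"
  shows "U - l1 *\<^sub>R (gR - gL) - l2 *\<^sub>R (hR - hL) \<in> G"
proof -
  let ?A = "U - (2 * l1) *\<^sub>R (gR - gL)" and ?B = "U - (2 * l2) *\<^sub>R (hR - hL)"
  have "?A \<in> G" "?B \<in> G"
    using convex_update_1d[OF assms(1,2) _ assms(5,7,8)]
      convex_update_1d[OF assms(1,2) _ assms(6,9,10)] assms(3,4) by simp_all
  then have "(1/2) *\<^sub>R ?A + (1/2) *\<^sub>R ?B \<in> G"
    using assms(1) by (intro convexD) auto
  also have "(1/2) *\<^sub>R ?A + (1/2) *\<^sub>R ?B = U - l1 *\<^sub>R (gR - gL) - l2 *\<^sub>R (hR - hL)"
    using scaleR_half_double[of U] by (simp add: algebra_simps)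
  finally show ?thesis .
qed

text \<open>For \<open>a = 0\<close> the quotient is infinite, and the claim reads
  \<open>0 \<le> 1\<close>.\<close>

lemma cfl_real:
  assumes "ereal dt \<le> 1/2 * (ereal w / ereal a)" "0 < w" "0 \<le> a"
  shows "2 * (dt / w) * a \<le> 1"
proof (cases "a = 0")
  case False
  have half: "(1/2 :: ereal) = ereal (1/2)"
    unfolding one_ereal_def numeral_eq_ereal by simp
  have "dt \<le> 1/2 * (w / a)"
    using assms(1) unfolding half by (simp add: False)
  with False assms(2,3) show ?thesis by (simp add: field_simps)
qed auto


section \<open>Invariance of convex sets under a limited stage and SSP-RK3\<close>

lemma width_pos: "strict_mono x \<Longrightarrow> 0 < width x i"
  by (simp add: width_def strict_mono_less)

text \<open>All three kinds of points have the same update with different neighbours and spacings,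
  so each is an instance of \<open>convex_update_2d\<close>.\<close>

lemma pv_low_in:
  assumes xy: "strict_mono x" "strict_mono y" and dt: "0 < dt" and G: "convex G"
    and F: "llf_admissible G F1" "llf_admissible G F2"
    and U: "dofs_in G U" and cfl: "cfl_pv x y F1 F2 dt U"
  shows "pv_low x y F1 F2 dt U \<sigma> \<in> G"
proof -
  have pv [simp]: "pv U \<sigma> \<in> G" for \<sigma>
    using U by (simp add: dofs_in_def)
  have split: "split_flux G F1 (alpha F1 (pv U \<sigma>) (pv U \<tau>)) (pv U \<sigma>) (pv U \<tau>)
        (llf F1 (pv U \<sigma>) (pv U \<tau>))"
    "split_flux G F2 (alpha F2 (pv U \<sigma>) (pv U \<tau>)) (pv U \<sigma>) (pv U \<tau>)
        (llf F2 (pv U \<sigma>) (pv U \<tau>))" for \<sigma> \<tau>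
    using F by (simp_all add: split_flux_llf)
  have al: "0 \<le> alpha F1 (pv U \<sigma>) (pv U \<tau>)" "0 \<le> alpha F2 (pv U \<sigma>) (pv U \<tau>)" for \<sigma> \<tau>
    using F by (auto simp: llf_admissible_def)
  have w [simp]: "0 < width x i" "0 < width y i" for i
    using xy width_pos by auto
  have w2 [simp]: "0 < width x i + width x k" "0 < width y i + width y k" for i k
    by (simp_all add: add_pos_pos)
  have le: "ereal dt \<le> 1/2 * q" if "ereal dt \<le> 1/2 * Min S" "finite S" "q \<in> S" for q :: ereal and S
    using that(1) ereal_mult_left_mono[OF Min_le[OF that(2,3)], of "1/2"] by simp
  \<comment> \<open>\<open>c1\<close> serves directions with a cell width as spacing,
    \<open>c2\<close> those with the mean of two adjacent widths.\<close>
  have c1: "2 * (dt / w) * (aL + aR) \<le> 1"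
    if "ereal dt \<le> 1/2 * (ereal w / ereal (aR + aL))" "0 < w" "0 \<le> aL" "0 \<le> aR" for w aL aR
    using cfl_real[OF that(1,2)] that(3,4) by (simp add: add.commute)
  have c2: "2 * (2 * dt / w) * (aL + aR) \<le> 1"
    if "ereal dt \<le> 1/2 * (ereal w / ereal (2 * (aL + aR)))" "0 < w" "0 \<le> aL" "0 \<le> aR" for w aL aR
    using cfl_real[OF that(1,2)] that(3,4) by (simp add: mult_ac)
  note cfl' = le[OF cfl[unfolded cfl_pv_def Let_def, rule_format]]
  note step = convex_update_2d[OF G pv]
  show ?thesis
  proof (cases \<sigma>)
    case (Node i j)
    \<comment> \<open>Membership in the six-element set picks the quotient of the time-step
      condition. Its coefficients at \<open>i+1\<close> refer to \<open>i+1-1\<close>, which has to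
      be reduced to \<open>i\<close>.\<close>
    show ?thesis
      unfolding Node pv_low.simps Let_def
      by (rule step[OF _ _ c2[OF cfl'[of i j]] c2[OF cfl'[of i j]] split(1) split(1) split(2) split(2)])
        ((simp only: insert_iff add_diff_cancel_right' simp_thms; fail)
          | (use dt less_imp_le[OF w2(1)] less_imp_le[OF w2(2)] in \<open>simp add: al; fail\<close>))+
  next
    case (VFace i j)
    show ?thesis
      unfolding VFace pv_low.simps Let_def
      by (rule step[OF _ _ c2[OF cfl'[of i j]] c1[OF cfl'[of i j]] split(1) split(1) split(2) split(2)])
        ((simp only: insert_iff add_diff_cancel_right' simp_thms; fail)
          | (use dt less_imp_le[OF w2(1)] less_imp_le[OF w(2)] in \<open>simp add: al; fail\<close>))+
  next
    case (HFace i j)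
    show ?thesis
      unfolding HFace pv_low.simps Let_def
      by (rule step[OF _ _ c1[OF cfl'[of i j]] c2[OF cfl'[of i j]] split(1) split(1) split(2) split(2)])
        ((simp only: insert_iff add_diff_cancel_right' simp_thms; fail)
          | (use dt less_imp_le[OF w(1)] less_imp_le[OF w2(2)] in \<open>simp add: al; fail\<close>))+
  qed
qed

text \<open>Limited fluxes keep the coefficients of the Lax-Friedrichs flux, so the condition on the
  step size is unchanged. \<open>plim\<close> is tested on the actual low-order states, which lie in
  \<open>G\<close> by \<open>pv_low_in\<close>.\<close>

lemma limited_stage_dofs_in:
  assumes xy: "strict_mono x" "strict_mono y" and dt: "0 < dt" and G: "convex G"
    and F: "llf_admissible G F1" "llf_admissible G F2"
    and U: "dofs_in G U" and cfl: "cfl_avg x y F1 F2 dt U" "cfl_pv x y F1 F2 dt U"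
    and lim1: "\<And>i j. split_flux G F1 (alpha F1 (avg U i j) (avg U (i+1) j))
      (avg U i j) (avg U (i+1) j) (lim1 (\<lambda>k. avg U k j) (FH1 U i j) i)"
    and lim2: "\<And>i j. split_flux G F2 (alpha F2 (avg U i j) (avg U i (j+1)))
      (avg U i j) (avg U i (j+1)) (lim2 (\<lambda>k. avg U i k) (FH2 U i j) j)"
    and plim: "\<And>\<sigma> UH. pv_low x y F1 F2 dt U \<sigma> \<in> G \<Longrightarrow>
      plim (pv_low x y F1 F2 dt U \<sigma>) UH \<in> G"
  shows "dofs_in G (limited_stage x y F1 F2 FH1 FH2 R lim1 lim2 plim dt U)"
proof -
  have avg: "avg U i j \<in> G" for i j
    using U by (simp add: dofs_in_def)
  have al: "0 \<le> alpha F1 (avg U i j) (avg U k l)" "0 \<le> alpha F2 (avg U i j) (avg U k l)" for i j k l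
    using F avg by (auto simp: llf_admissible_def)
  have w: "0 < width x i" "0 < width y i" for i
    using xy width_pos by auto
  have le: "ereal dt \<le> 1/2 * p \<and> ereal dt \<le> 1/2 * q" if "ereal dt \<le> 1/2 * min p q" for p q :: ereal
    using that ereal_mult_left_mono[of "min p q" p "1/2"] ereal_mult_left_mono[of "min p q" q "1/2"]
    by (auto intro: order_trans)
  note cfl' = le[OF cfl(1)[unfolded cfl_avg_def Let_def, rule_format]]
  have "avg U i j
      - (dt / width x i) *\<^sub>R (lim1 (\<lambda>k. avg U k j) (FH1 U i j) i
          - lim1 (\<lambda>k. avg U k j) (FH1 U (i - 1) j) (i - 1))
      - (dt / width y j) *\<^sub>R (lim2 (\<lambda>k. avg U i k) (FH2 U i j) j
          - lim2 (\<lambda>k. avg U i k) (FH2 U i (j - 1)) (j - 1)) \<in> G" for i j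
    using lim1[of "i - 1" j] lim2[of i "j - 1"] dt less_imp_le[OF w(1)] less_imp_le[OF w(2)]
    by (intro convex_update_2d[OF G avg _ _ cfl_real[OF conjunct1[OF cfl'[of i j]]]
          cfl_real[OF conjunct2[OF cfl'[of i j]]] lim1 _ lim2])
      (simp_all add: al w)
  then show ?thesis
    using plim pv_low_in[OF xy dt G F U cfl(2)]
    by (simp add: limited_stage_def dofs_in_def Let_def)
qed

lemma combine_dofs_in:
  assumes "convex G" "dofs_in G U" "dofs_in G W" "0 \<le> a" "0 \<le> b" "a + b = 1"
  shows "dofs_in G (combine a U b W)"
  using convexD[OF assms(1) _ _ assms(4-6)] assms(2,3) by (simp add: dofs_in_def combine_def)

text \<open>The stages are handled in order: each start state is shown to lie in \<open>G\<close>
  before the stage hypothesis is applied to it.\<close>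

lemma ssp_rk3_dofs_in:
  assumes "convex G" "dofs_in G U"
    and "\<And>W. W \<in> rk_stages S U \<Longrightarrow> dofs_in G W \<Longrightarrow> dofs_in G (S W)"
  shows "dofs_in G (ssp_rk3 S U)"
proof -
  have S: "dofs_in G (S U)"
    using assms(2) by (intro assms(3)) (simp_all add: rk_stages_def)
  have "dofs_in G (S (S U))"
    using S by (rule assms(3)[rotated]) (simp add: rk_stages_def)
  then have "dofs_in G (rk_stage2 S U)"
    unfolding rk_stage2_def by (rule combine_dofs_in[OF assms(1,2)]) simp_all
  then have "dofs_in G (S (rk_stage2 S U))"
    by (rule assms(3)[rotated]) (simp add: rk_stages_def)
  then show ?thesis
    unfolding ssp_rk3_def by (rule combine_dofs_in[OF assms(1,2)]) simp_all
qed

lemma ssp_rk3_iterate_dofs_in: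
  assumes "convex G" "dofs_in G (u 0)"
    and step: "\<And>n. n < N \<Longrightarrow> u (Suc n) = ssp_rk3 (S n) (u n)"
    and stage: "\<And>n W. n < N \<Longrightarrow> W \<in> rk_stages (S n) (u n) \<Longrightarrow> dofs_in G W \<Longrightarrow> dofs_in G (S n W)"
  shows "n \<le> N \<Longrightarrow> dofs_in G (u n)"
proof (induction n)
  case 0
  show ?case by (rule assms(2))
next
  case (Suc n)
  then have "n < N" and "dofs_in G (u n)" by simp_all
  then show ?case
    unfolding step[OF \<open>n < N\<close>] using stage by (intro ssp_rk3_dofs_in[OF assms(1)]) auto
qed


section \<open>Wave speeds\<close>

text \<open>
  Only lower bounds on the spectral radius are needed. They require its defining set to be bounded
  above, since \<open>Sup\<close> of an unbounded set of reals is unspecified.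
\<close>

lemma abs_eigenvalue_le_spectral_radius:
  fixes L :: "'a::real_inner \<Rightarrow> 'a"
  assumes "bounded_linear L" "r \<noteq> 0" "L r = c *\<^sub>R r"
  shows "\<bar>c\<bar> \<le> spectral_radius L"
  unfolding spectral_radius_def
proof (rule cSup_upper)
  show "\<bar>c\<bar> \<in> {cmod z | z. \<exists>p q. (p \<noteq> 0 \<or> q \<noteq> 0) \<and>
      L p = Re z *\<^sub>R p - Im z *\<^sub>R q \<and> L q = Im z *\<^sub>R p + Re z *\<^sub>R q}"
    using assms(2,3) bounded_linear.linear[OF assms(1)]
    by (intro CollectI exI[of _ "of_real c"] exI[of _ r] exI[of _ 0] conjI) (auto simp: linear_0)
  obtain K where K: "\<And>p. norm (L p) \<le> norm p * K" "0 < K"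
    using bounded_linear.pos_bounded[OF assms(1)] by blast
  have "cmod z \<le> K"
    if pq: "p \<noteq> 0 \<or> q \<noteq> 0"
      "L p = Re z *\<^sub>R p - Im z *\<^sub>R q" "L q = Im z *\<^sub>R p + Re z *\<^sub>R q" for z p q
  proof -
    let ?N = "(norm p)\<^sup>2 + (norm q)\<^sup>2"
    \<comment> \<open>The pair \<open>(L p, L q)\<close> is \<open>(p, q)\<close> rotated and
      stretched by \<open>z\<close>; the mixed inner products cancel. Hence \<open>cmod z\<close> is
      at most the operator bound \<open>K\<close>.\<close>
    have "(cmod z)\<^sup>2 * ?N = (norm (L p))\<^sup>2 + (norm (L q))\<^sup>2"
      unfolding pq(2,3) cmod_power2 power2_norm_eq_inner[of p] power2_norm_eq_inner[of q]
        power2_norm_eq_inner[of "_ - _"] power2_norm_eq_inner[of "_ + _"]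
      by (simp add: inner_diff_left inner_diff_right inner_add_left inner_add_right
          inner_commute power2_eq_square algebra_simps)
    also have "\<dots> \<le> (norm p * K)\<^sup>2 + (norm q * K)\<^sup>2"
      using K by (intro add_mono power_mono) auto
    also have "\<dots> = K\<^sup>2 * ?N"
      by (simp add: power_mult_distrib algebra_simps)
    finally have "(cmod z)\<^sup>2 * ?N \<le> K\<^sup>2 * ?N" .
    moreover have "0 < ?N"
      using pq(1) by (auto simp: sum_power2_gt_zero_iff)
    ultimately show ?thesis
      using K(2) by (simp add: abs_le_square_iff[symmetric])
  qed
  then show "bdd_above {cmod z | z. \<exists>p q. (p \<noteq> 0 \<or> q \<noteq> 0) \<and>
      L p = Re z *\<^sub>R p - Im z *\<^sub>R q \<and> L q = Im z *\<^sub>R p + Re z *\<^sub>R q}"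
    by (auto intro!: bdd_aboveI[of _ K])
qed

text \<open>Derivatives are unique, so an eigenvector of any exhibited derivative \<open>D\<close>
  will do.\<close>

lemma abs_eigenvalue_le_wave_speed:
  assumes "(F has_derivative D) (at U)" "r \<noteq> 0" "D r = c *\<^sub>R r"
  shows "\<bar>c\<bar> \<le> wave_speed F U"
  unfolding wave_speed_def frechet_derivative_at[OF assms(1), symmetric]
  using assms by (intro abs_eigenvalue_le_spectral_radius has_derivative_bounded_linear)


section \<open>Scalar conservation laws\<close>

text \<open>Mean value inequality on the segment: \<open>deriv f u\<close> is an eigenvalue of the
  derivative, with eigenvector 1, and \<open>admissible_flux\<close> bounds the wave speed inside
  the segment by \<open>alpha\<close>.\<close>

lemma scalar_lipschitz:
  assumes "admissible_flux {m0..M0} f" "V \<in> {m0..M0}" "W \<in> {m0..M0}"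
  shows "\<bar>f V - f W\<bar> \<le> alpha f V W * \<bar>V - W\<bar>"
proof -
  have "norm (f V - f W) \<le> alpha f V W * norm (V - W)"
  proof (rule field_differentiable_bound)
    let ?S = "closed_segment V W"
    show "convex ?S" "V \<in> ?S" "W \<in> ?S" by auto
    fix u assume u: "u \<in> ?S"
    then have "u \<in> {m0..M0}"
      using assms(2,3) closed_segment_subset[of V "{m0..M0}" W] by auto
    then have "f differentiable at u"
      using assms(1) by (auto simp: admissible_flux_def)
    then have d: "(f has_real_derivative deriv f u) (at u)"
      by (simp add: DERIV_deriv_iff_real_differentiable)
    then show "(f has_field_derivative deriv f u) (at u within ?S)"
      by (rule has_field_derivative_at_within)
    have "\<bar>deriv f u\<bar> \<le> wave_speed f u"
      using d by (intro abs_eigenvalue_le_wave_speed[of f "(*) (deriv f u)" u 1])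
        (auto simp: has_field_derivative_def)
    also have "\<dots> \<le> alpha f V W"
      using assms u by (auto simp: admissible_flux_def)
    finally show "norm (deriv f u) \<le> alpha f V W" by simp
  qed
  then show ?thesis by simp
qed

text \<open>Not automatic, as the wave speed is a supremum; the modulus of the eigenvalue
  \<open>D 1\<close> bounds it from below.\<close>

lemma scalar_alpha_nonneg:
  assumes "admissible_flux {m0..M0} f" "V \<in> {m0..M0}" "W \<in> {m0..M0}"
  shows "0 \<le> alpha f V W"
proof -
  have "f differentiable at V"
    using assms by (auto simp: admissible_flux_def)
  then obtain D where D: "(f has_derivative D) (at V)"
    by (auto simp: differentiable_def)
  have "0 \<le> \<bar>D 1\<bar>" by simp
  also have "\<dots> \<le> wave_speed f V"
    by (rule abs_eigenvalue_le_wave_speed[OF D, of 1]) auto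
  finally show ?thesis by (simp add: alpha_def)
qed

text \<open>\<open>mid\<close> is the arithmetic mean plus \<open>q\<close>, and
  \<open>scalar_lipschitz\<close> gives \<open>|q| \<le> |V - W| / 2\<close>, so \<open>mid\<close>
  lies between \<open>V\<close> and \<open>W\<close>. If \<open>alpha\<close> vanishes, division by
  zero makes \<open>q = 0\<close>.\<close>

lemma scalar_mid_in:
  assumes "admissible_flux {m0..M0} f" "V \<in> {m0..M0}" "W \<in> {m0..M0}"
  shows "mid f V W \<in> {m0..M0}"
proof -
  define q where "q = (f V - f W) / (2 * alpha f V W)"
  have q: "2 * \<bar>q\<bar> \<le> \<bar>V - W\<bar>"
    using scalar_lipschitz[OF assms] scalar_alpha_nonneg[OF assms]
    by (cases "alpha f V W = 0") (auto simp: q_def abs_mult field_simps)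
  have mid: "2 * mid f V W = V + W + 2 * q"
    by (simp add: mid_def q_def)
  have "m0 \<le> V" "V \<le> M0" "m0 \<le> W" "W \<le> M0"
    using assms(2,3) by auto
  then have "m0 \<le> mid f V W" "mid f V W \<le> M0"
    using q mid by linarith+
  then show ?thesis by simp
qed

lemma scalar_llf_admissible:
  assumes "admissible_flux {m0..M0} f"
  shows "llf_admissible {m0..M0} f"
  unfolding llf_admissible_def
proof (intro ballI conjI impI)
  fix V W assume VW: "V \<in> {m0..M0}" "W \<in> {m0..M0}"
  show "0 \<le> alpha f V W"
    by (rule scalar_alpha_nonneg[OF assms VW])
  show "mid f V W \<in> {m0..M0}"
    by (rule scalar_mid_in[OF assms VW])
  show "f V = f W" if "alpha f V W = 0"
    using scalar_lipschitz[OF assms VW] that by simp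
qed

section \<open>Limiters for scalar conservation laws\<close>

lemma bound_min_between:
  assumes "admissible_flux {m0..M0} f" "\<And>k. w k \<in> {m0..M0}"
  shows "m0 \<le> bound_min b m0 f w k" "bound_min b m0 f w k \<le> mid f (w k) (w (k+1))"
    "bound_min b m0 f w (k+1) \<le> mid f (w k) (w (k+1))"
  \<comment> \<open>The state between cells \<open>k\<close> and \<open>k+1\<close> is the right one
    for \<open>k\<close> and the left one for \<open>k+1\<close>; it enters the local bounds of
    both.\<close>
  using scalar_mid_in[OF assms(1) assms(2) assms(2)] assms(2) by (cases b; force)+

lemma bound_max_between:
  assumes "admissible_flux {m0..M0} f" "\<And>k. w k \<in> {m0..M0}"
  shows "bound_max b M0 f w k \<le> M0" "mid f (w k) (w (k+1)) \<le> bound_max b M0 f w k"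
    "mid f (w k) (w (k+1)) \<le> bound_max b M0 f w (k+1)"
  using scalar_mid_in[OF assms(1) assms(2) assms(2)] assms(2) by (cases b; force)+

text \<open>\<open>d \<le> a * p\<close> keeps \<open>ut - d / a\<close> above the lower bound of
  cell \<open>k\<close> and \<open>ut + d / a\<close> below the upper bound of cell
  \<open>k+1\<close>; \<open>a * q \<le> d\<close> gives the other two bounds.\<close>

lemma scalar_flux_lim_split:
  assumes f: "admissible_flux {m0..M0} f" and w: "\<And>k. w k \<in> {m0..M0}"
  shows "split_flux {m0..M0} f (alpha f (w k) (w (k+1))) (w k) (w (k+1))
    (scalar_flux_lim b m0 M0 f w fH k)"
proof -
  define a where "a = alpha f (w k) (w (k+1))"
  define ut where "ut = mid f (w k) (w (k+1))"
  define d where "d = scalar_flux_lim b m0 M0 f w fH k - llf f (w k) (w (k+1))"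
  let ?l = "bound_min b m0 f w" and ?u = "bound_max b M0 f w"
  have a: "0 \<le> a"
    unfolding a_def by (rule scalar_alpha_nonneg[OF f w w])
  have bounds: "m0 \<le> ?l k" "m0 \<le> ?l (k+1)" "?l k \<le> ut" "?l (k+1) \<le> ut"
    "?u k \<le> M0" "?u (k+1) \<le> M0" "ut \<le> ?u k" "ut \<le> ?u (k+1)"
    using bound_min_between[OF f w] bound_max_between[OF f w] by (simp_all add: ut_def)
  define p where "p = min (ut - ?l k) (?u (k+1) - ut)"
  define q where "q = max (?l (k+1) - ut) (ut - ?u k)"
  \<comment> \<open>As \<open>q \<le> 0 \<le> p\<close>, clipping \<open>d\<close> only on the side
    of its sign enforces both inequalities. For \<open>a = 0\<close> they force
    \<open>d = 0\<close>.\<close>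
  have "0 \<le> a * p" "a * q \<le> 0"
    using bounds a by (auto simp: p_def q_def intro: mult_nonneg_nonneg mult_nonneg_nonpos)
  then have d: "d \<le> a * p" "a * q \<le> d"
    unfolding d_def scalar_flux_lim_def Let_def a_def[symmetric] ut_def[symmetric]
      p_def[symmetric] q_def[symmetric] by (auto simp: max_def)
  have "ut - 1 / a * d \<in> {m0..M0} \<and> ut + 1 / a * d \<in> {m0..M0}" if "0 < a"
  proof -
    have "d / a \<le> p" "q \<le> d / a"
      using d that by (simp_all add: field_simps)
    with bounds show ?thesis by (auto simp: p_def q_def)
  qed
  moreover have "d = 0" if "a = 0"
    using d that by simp
  ultimately have "split_flux {m0..M0} f a (w k) (w (k+1)) (llf f (w k) (w (k+1)) + d)"
    unfolding a_def ut_def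
    by (intro split_flux_corrected_llf scalar_llf_admissible f w) auto
  then show ?thesis by (simp add: a_def d_def)
qed

text \<open>Only the bound on the side of \<open>uH\<close> can be violated. Numerator and
  denominator of its quotient do not differ in sign, so the absolute value is harmless and
  \<open>t * |uH - uL|\<close> is at most the distance from \<open>uL\<close> to that bound.\<close>

lemma scalar_pv_lim_in:
  assumes "uL \<in> {m0..M0}"
  shows "scalar_pv_lim m0 M0 uL uH \<in> {m0..M0}"
proof -
  define t where "t = Min {\<bar>(uL - m0) / (uL - uH)\<bar>, \<bar>(M0 - uL) / (uH - uL)\<bar>, 1}"
  have t0: "0 \<le> t"
    by (simp add: t_def)
  have t: "t \<le> \<bar>(uL - m0) / (uL - uH)\<bar>" "t \<le> \<bar>(M0 - uL) / (uH - uL)\<bar>"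
    unfolding t_def by (intro Min_le finite.intros insertI1 insertI2)+
  have eq: "scalar_pv_lim m0 M0 uL uH = uL + t * (uH - uL)"
    unfolding scalar_pv_lim_def Let_def t_def[symmetric] by (simp add: algebra_simps)
  consider "uH = uL" | "uH < uL" | "uL < uH" by linarith
  then show ?thesis
  proof cases
    case 1
    then show ?thesis using assms eq by simp
  next
    case 2
    with assms have "\<bar>(uL - m0) / (uL - uH)\<bar> = (uL - m0) / (uL - uH)"
      by (intro abs_of_nonneg divide_nonneg_pos) auto
    with 2 t0 t(1) have "t * (uL - uH) \<le> uL - m0" "0 \<le> t * (uL - uH)"
      by (simp_all add: pos_le_divide_eq)
    then show ?thesis using assms eq by (simp add: right_diff_distrib)
  next
    case 3
    with assms have "\<bar>(M0 - uL) / (uH - uL)\<bar> = (M0 - uL) / (uH - uL)"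
      by (intro abs_of_nonneg divide_nonneg_pos) auto
    with 3 t0 t(2) have "t * (uH - uL) \<le> M0 - uL" "0 \<le> t * (uH - uL)"
      by (simp_all add: pos_le_divide_eq)
    then show ?thesis using assms eq by (simp add: right_diff_distrib)
  qed
qed

lemma scalar_stage_dofs_in:
  assumes "strict_mono x" "strict_mono y" "0 < dt"
    and f: "admissible_flux {m0..M0} f1" "admissible_flux {m0..M0} f2"
    and w: "dofs_in {m0..M0} w" "cfl_avg x y f1 f2 dt w" "cfl_pv x y f1 f2 dt w"
  shows "dofs_in {m0..M0} (scalar_stage b m0 M0 x y f1 f2 fH1 fH2 R dt w)"
  unfolding scalar_stage_def
proof (rule limited_stage_dofs_in)
  have avg: "avg w i j \<in> {m0..M0}" for i j
    using w by (simp add: dofs_in_def)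
  show "split_flux {m0..M0} f1 (alpha f1 (avg w i j) (avg w (i+1) j)) (avg w i j) (avg w (i+1) j)
      (scalar_flux_lim b m0 M0 f1 (\<lambda>k. avg w k j) (fH1 w i j) i)" for i j
    using scalar_flux_lim_split[OF f(1), of "\<lambda>k. avg w k j"] avg by blast
  show "split_flux {m0..M0} f2 (alpha f2 (avg w i j) (avg w i (j+1))) (avg w i j) (avg w i (j+1))
      (scalar_flux_lim b m0 M0 f2 (\<lambda>k. avg w i k) (fH2 w i j) j)" for i j
    using scalar_flux_lim_split[OF f(2), of "\<lambda>k. avg w i k"] avg by blast
qed (use assms scalar_llf_admissible scalar_pv_lim_in in auto)


section \<open>Compressible Euler equations\<close>

text \<open>Multiplication by the density removes the quotient; this polynomial form is the one
  checked for shifted states.\<close>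

lemma euler_G_iff:
  assumes "1 < \<gamma>"
  shows "U \<in> euler_G \<gamma> \<longleftrightarrow> 0 < dens U \<and> (norm (mom U))\<^sup>2 < 2 * dens U * energy U"
proof -
  have "0 < pressure \<gamma> U \<longleftrightarrow> (norm (mom U))\<^sup>2 / (2 * dens U) < energy U"
    using assms by (simp add: pressure_def zero_less_mult_iff)
  then show ?thesis
    by (auto simp: euler_G_def pos_divide_less_eq mult_ac)
qed

lemma norm_mom: "(norm (m :: real \<times> real))\<^sup>2 = (fst m)\<^sup>2 + (snd m)\<^sup>2"
  by (simp add: norm_prod_def)

text \<open>Joint convexity of \<open>|m|^2 / r\<close> in \<open>m\<close> and \<open>r\<close>, in
  homogeneous form. After clearing denominators the defect is the square
  \<open>|s a - r b|^2\<close>.\<close>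

lemma power2_norm_add_div_le:
  fixes a b :: "'a::real_inner"
  assumes "0 < r" "0 < s"
  shows "(norm (a + b))\<^sup>2 / (r + s) \<le> (norm a)\<^sup>2 / r + (norm b)\<^sup>2 / s"
proof -
  have "0 \<le> (norm (s *\<^sub>R a - r *\<^sub>R b))\<^sup>2" by simp
  then have "r * s * (norm (a + b))\<^sup>2 \<le> (r + s) * (s * (norm a)\<^sup>2 + r * (norm b)\<^sup>2)"
    unfolding power2_norm_eq_inner
    by (simp add: inner_add_left inner_add_right inner_diff_left inner_diff_right
        inner_commute[of b a] algebra_simps)
  moreover have "(norm a)\<^sup>2 / r + (norm b)\<^sup>2 / s = (s * (norm a)\<^sup>2 + r * (norm b)\<^sup>2) / (r * s)"
    using assms by (simp add: field_simps)
  ultimately show ?thesis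
    using assms by (simp add: divide_le_eq le_divide_eq mult_ac)
qed

text \<open>The energy is linear and the kinetic energy convex. Positivity is asked of the densities
  alone, because the density-limited state may have negative pressure.\<close>

lemma pressure_concave:
  assumes "1 < \<gamma>" "0 < dens U" "0 < dens W" "0 \<le> a" "0 \<le> b" "a + b = 1"
  shows "a * pressure \<gamma> U + b * pressure \<gamma> W \<le> pressure \<gamma> (a *\<^sub>R U + b *\<^sub>R W)"
\<comment> \<open>Zero weights are set aside because \<open>power2_norm_add_div_le\<close> needs
  both weighted densities positive.\<close>
proof (cases "a = 0 \<or> b = 0")
  case True
  with assms show ?thesis by auto
next
  case False
  with assms have ab: "0 < a" "0 < b" by auto
  have div: "(c * norm m)\<^sup>2 / (c * r) = c * ((norm m)\<^sup>2 / r)" if "0 < c" for c r and m :: "real \<times> real"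
    using that by (simp add: power_mult_distrib power2_eq_square)
  define p where "p = (norm (mom U))\<^sup>2 / dens U"
  define q where "q = (norm (mom W))\<^sup>2 / dens W"
  define m where "m = (norm (a *\<^sub>R mom U + b *\<^sub>R mom W))\<^sup>2 / (a * dens U + b * dens W)"
  have "m \<le> a * p + b * q"
    using power2_norm_add_div_le[of "a * dens U" "b * dens W" "a *\<^sub>R mom U" "b *\<^sub>R mom W"]
      ab assms(2,3) by (simp add: div m_def p_def q_def)
  then have "a * (energy U - p / 2) + b * (energy W - q / 2) \<le> a * energy U + b * energy W - m / 2"
    by (simp add: algebra_simps)
  then have "(\<gamma> - 1) * (a * (energy U - p / 2) + b * (energy W - q / 2)) \<le>
      (\<gamma> - 1) * (a * energy U + b * energy W - m / 2)"
    using assms(1) by (intro mult_left_mono) simp_all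
  moreover have "pressure \<gamma> U = (\<gamma> - 1) * (energy U - p / 2)"
    "pressure \<gamma> W = (\<gamma> - 1) * (energy W - q / 2)"
    "pressure \<gamma> (a *\<^sub>R U + b *\<^sub>R W) = (\<gamma> - 1) * (a * energy U + b * energy W - m / 2)"
    by (simp_all add: pressure_def p_def q_def m_def mult.commute)
  ultimately show ?thesis
    by (simp add: distrib_left mult.left_commute)
qed

lemma convex_euler_G:
  assumes "1 < \<gamma>"
  shows "convex (euler_G \<gamma>)"
proof (rule convexI)
  fix U W :: euler_state and a b :: real
  assume U: "U \<in> euler_G \<gamma>" and W: "W \<in> euler_G \<gamma>" and ab: "0 \<le> a" "0 \<le> b" "a + b = 1"
  have pos: "0 < a * s + b * t" if "0 < s" "0 < t" for s t :: real
    using that ab by (cases "a = 0") (auto intro: add_pos_nonneg)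
  have "0 < a * pressure \<gamma> U + b * pressure \<gamma> W"
    using U W by (intro pos) (auto simp: euler_G_def)
  also have "\<dots> \<le> pressure \<gamma> (a *\<^sub>R U + b *\<^sub>R W)"
    using U W ab assms by (intro pressure_concave) (auto simp: euler_G_def)
  finally show "a *\<^sub>R U + b *\<^sub>R W \<in> euler_G \<gamma>"
    using U W pos by (auto simp: euler_G_def)
qed

text \<open>The set is a cone, since both conditions are homogeneous; shifted states can thus be
  multiplied by \<open>a\<close>.\<close>

lemma scaleR_euler_G_iff:
  assumes "1 < \<gamma>" "0 < c"
  shows "c *\<^sub>R U \<in> euler_G \<gamma> \<longleftrightarrow> U \<in> euler_G \<gamma>"
proof -
  have "(norm (mom (c *\<^sub>R U)))\<^sup>2 < 2 * dens (c *\<^sub>R U) * energy (c *\<^sub>R U) \<longleftrightarrow>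
      c\<^sup>2 * (norm (mom U))\<^sup>2 < c\<^sup>2 * (2 * dens U * energy U)"
    using assms(2) by (simp add: power_mult_distrib power2_eq_square mult_ac)
  also have "\<dots> \<longleftrightarrow> (norm (mom U))\<^sup>2 < 2 * dens U * energy U"
    using assms(2) by (simp add: mult.assoc)
  finally show ?thesis
    using assms by (simp add: euler_G_iff zero_less_mult_iff)
qed

section \<open>Acoustic eigenvalues of the Euler flux and shifted states\<close>

definition sound_speed :: "real \<Rightarrow> euler_state \<Rightarrow> real" where
  "sound_speed \<gamma> U = sqrt (\<gamma> * pressure \<gamma> U / dens U)"

text \<open>\<open>dp\<close> is the differential of the pressure and \<open>H\<close> the specific
  total enthalpy. Writing the base point by velocities confines all quotients to
  \<open>H\<close>.\<close>

lemma euler_flux1_has_derivative: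
  fixes \<gamma> r v1 v2 E :: real
  assumes "r \<noteq> 0"
  defines "dp \<equiv> (\<lambda>h :: euler_state. (\<gamma> - 1) *
      (energy h - v1 * fst (mom h) - v2 * snd (mom h) + (v1\<^sup>2 + v2\<^sup>2) / 2 * dens h))"
    and "H \<equiv> (E + (\<gamma> - 1) * (E - r * (v1\<^sup>2 + v2\<^sup>2) / 2)) / r"
  shows "(euler_flux1 \<gamma> has_derivative (\<lambda>h. (fst (mom h),
      (2 * v1 * fst (mom h) - v1\<^sup>2 * dens h + dp h,
       v1 * snd (mom h) + v2 * fst (mom h) - v1 * v2 * dens h),
      v1 * (energy h + dp h) + H * (fst (mom h) - v1 * dens h)))) (at (r, (r * v1, r * v2), E))"
  unfolding euler_flux1_def Let_def pressure_def velocity_def norm_mom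
  by (rule derivative_eq_intros refl | simp add: assms(1))+
    (use assms(1) in \<open>simp add: fun_eq_iff dp_def H_def, intro conjI allI;
      simp add: field_simps power2_eq_square\<close>)

lemma euler_flux1_eigenvector:
  assumes "1 < \<gamma>" "U \<in> euler_G \<gamma>" "\<bar>s\<bar> = 1"
  obtains D R where "(euler_flux1 \<gamma> has_derivative D) (at U)" "R \<noteq> 0"
    "D R = (fst (velocity U) + s * sound_speed \<gamma> U) *\<^sub>R R"
proof -
  define r where "r = dens U"
  define E where "E = energy U"
  define v1 where "v1 = fst (velocity U)"
  define v2 where "v2 = snd (velocity U)"
  define c where "c = sound_speed \<gamma> U"
  define H where "H = (E + (\<gamma> - 1) * (E - r * (v1\<^sup>2 + v2\<^sup>2) / 2)) / r"
  have pos: "0 < r" "0 < pressure \<gamma> U"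
    using assms(2) by (auto simp: euler_G_def r_def)
  have U: "U = (r, (r * v1, r * v2), E)"
    using pos by (simp add: r_def v1_def v2_def E_def velocity_def prod_eq_iff)
  have p: "pressure \<gamma> U = (\<gamma> - 1) * (E - r * (v1\<^sup>2 + v2\<^sup>2) / 2)"
    using pos(1) unfolding U pressure_def norm_mom by (simp add: power2_eq_square field_simps)
  have "c\<^sup>2 = \<gamma> * pressure \<gamma> U / r"
    using pos assms(1) by (simp add: c_def sound_speed_def r_def)
  also have "\<dots> = (\<gamma> - 1) * (H - (v1\<^sup>2 + v2\<^sup>2) / 2)"
    using pos(1) unfolding p H_def by (simp add: field_simps)
  finally have c2: "(\<gamma> - 1) * (H - (v1\<^sup>2 + v2\<^sup>2) / 2) = c\<^sup>2" ..
  have s2: "s\<^sup>2 = 1"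
    using assms(3) by (simp add: abs_square_eq_1)
  \<comment> \<open>The classical acoustic eigenvector. The pressure differential along it is
    \<open>c^2\<close>: the terms \<open>s * c * v1\<close> cancel, and
    \<open>(\<gamma> - 1) * (H - |v|^2 / 2) = c^2\<close>.\<close>
  define R :: euler_state where "R = (1, (v1 + s * c, v2), H + s * c * v1)"
  have "(\<gamma> - 1) * (energy R - v1 * fst (mom R) - v2 * snd (mom R) + (v1\<^sup>2 + v2\<^sup>2) / 2 * dens R)
      = (\<gamma> - 1) * (H - (v1\<^sup>2 + v2\<^sup>2) / 2)"
    by (simp add: R_def power2_eq_square algebra_simps)
  then have dp: "(\<gamma> - 1) * (energy R - v1 * fst (mom R) - v2 * snd (mom R)
      + (v1\<^sup>2 + v2\<^sup>2) / 2 * dens R) = (s * c)\<^sup>2"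
    using c2 s2 by (simp add: power_mult_distrib)
  show ?thesis
  proof (rule that)
    show "(euler_flux1 \<gamma> has_derivative (\<lambda>h. (fst (mom h),
        (2 * v1 * fst (mom h) - v1\<^sup>2 * dens h + (\<gamma> - 1) *
          (energy h - v1 * fst (mom h) - v2 * snd (mom h) + (v1\<^sup>2 + v2\<^sup>2) / 2 * dens h),
         v1 * snd (mom h) + v2 * fst (mom h) - v1 * v2 * dens h),
        v1 * (energy h + (\<gamma> - 1) *
          (energy h - v1 * fst (mom h) - v2 * snd (mom h) + (v1\<^sup>2 + v2\<^sup>2) / 2 * dens h))
          + H * (fst (mom h) - v1 * dens h)))) (at U)"
      (is "(_ has_derivative ?D) _")
      unfolding U H_def using pos(1) by (intro euler_flux1_has_derivative) simp
    show "R \<noteq> 0"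
      by (simp add: R_def prod_eq_iff)
    show "?D R = (fst (velocity U) + s * sound_speed \<gamma> U) *\<^sub>R R"
      unfolding dp v1_def[symmetric] c_def[symmetric]
      by (simp add: R_def power2_eq_square algebra_simps)
  qed
qed

text \<open>\<open>s\<close> is the sign of the velocity, so that the velocity and
  \<open>s * c\<close> add up in modulus.\<close>

lemma euler_flux1_wave_speed_ge:
  assumes "1 < \<gamma>" "U \<in> euler_G \<gamma>"
  shows "\<bar>fst (velocity U)\<bar> + sound_speed \<gamma> U \<le> wave_speed (euler_flux1 \<gamma>) U"
proof -
  define s where "s = (if 0 \<le> fst (velocity U) then 1 else -1 :: real)"
  obtain D R where D: "(euler_flux1 \<gamma> has_derivative D) (at U)" "R \<noteq> 0"
    "D R = (fst (velocity U) + s * sound_speed \<gamma> U) *\<^sub>R R"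
    using assms by (rule euler_flux1_eigenvector[of \<gamma> U s]) (auto simp: s_def)
  have "0 \<le> sound_speed \<gamma> U"
    using assms by (auto simp: sound_speed_def euler_G_def)
  then have "\<bar>fst (velocity U)\<bar> + sound_speed \<gamma> U = \<bar>fst (velocity U) + s * sound_speed \<gamma> U\<bar>"
    by (auto simp: s_def)
  then show ?thesis
    using abs_eigenvalue_le_wave_speed[OF D] by simp
qed

text \<open>With \<open>b = a + s * v1\<close>, the scaled state \<open>a U + s F(U)\<close> has
  \<open>2 r E - |m|^2\<close> equal to \<open>b^2\<close> times that of \<open>U\<close>, minus
  \<open>p^2\<close>. As that of \<open>U\<close> is \<open>2 r p / (\<gamma> - 1)\<close>,
  positivity amounts to \<open>(\<gamma> - 1) p < 2 r b^2\<close>, which follows from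
  \<open>b \<ge> c\<close>.\<close>

lemma euler_flux1_shift_in_G:
  assumes "1 < \<gamma>" "U \<in> euler_G \<gamma>" "\<bar>s\<bar> = 1" "\<bar>fst (velocity U)\<bar> + sound_speed \<gamma> U \<le> a"
  shows "0 < a" "U + (s / a) *\<^sub>R euler_flux1 \<gamma> U \<in> euler_G \<gamma>"
proof -
  define r where "r = dens U"
  define E where "E = energy U"
  define v1 where "v1 = fst (velocity U)"
  define v2 where "v2 = snd (velocity U)"
  define p where "p = pressure \<gamma> U"
  define c where "c = sound_speed \<gamma> U"
  define b where "b = a + s * v1"
  have pos: "0 < r" "0 < p"
    using assms(2) by (auto simp: euler_G_def r_def p_def)
  have U: "U = (r, (r * v1, r * v2), E)"
    using pos by (simp add: r_def v1_def v2_def E_def velocity_def prod_eq_iff)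
  have p: "2 * r * p = (\<gamma> - 1) * (2 * r * E - (r * v1)\<^sup>2 - (r * v2)\<^sup>2)"
    using pos(1) unfolding U p_def pressure_def norm_mom by (simp add: power2_eq_square field_simps)
  have c: "0 < c" "c\<^sup>2 = \<gamma> * p / r"
    using pos assms(1) by (simp_all add: c_def sound_speed_def p_def r_def)
  have s2: "s\<^sup>2 = 1"
    using assms(3) by (simp add: abs_square_eq_1)
  have "\<bar>s * v1\<bar> = \<bar>v1\<bar>"
    using assms(3) by (simp add: abs_mult)
  then have b: "c \<le> b" "0 < b" and a: "0 < a"
    using assms(4) c(1) by (auto simp: b_def v1_def c_def)
  show "0 < a" by (rule a)
  have "(\<gamma> - 1) * p < 2 * (\<gamma> * p)"
    using assms(1) pos by (simp add: algebra_simps add_pos_pos)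
  also have "\<dots> = 2 * r * c\<^sup>2"
    using pos by (simp add: c(2))
  also have "\<dots> \<le> 2 * r * b\<^sup>2"
    using b c(1) pos by (intro mult_left_mono power_mono) auto
  finally have "p * ((\<gamma> - 1) * p) < p * (2 * r * b\<^sup>2)"
    using pos(2) by (rule mult_strict_left_mono)
  also have "\<dots> = (\<gamma> - 1) * (b\<^sup>2 * (2 * r * E - (r * v1)\<^sup>2 - (r * v2)\<^sup>2))"
    using arg_cong[OF p, of "\<lambda>z. b\<^sup>2 * z"] by (simp add: mult_ac)
  finally have "(\<gamma> - 1) * p\<^sup>2 < (\<gamma> - 1) * (b\<^sup>2 * (2 * r * E - (r * v1)\<^sup>2 - (r * v2)\<^sup>2))"
    by (simp add: power2_eq_square mult_ac)
  then have "p\<^sup>2 < b\<^sup>2 * (2 * r * E - (r * v1)\<^sup>2 - (r * v2)\<^sup>2)"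
    using assms(1) by simp
  moreover have "2 * (b * r) * (b * E + s * p * v1) - ((b * (r * v1) + s * p)\<^sup>2 + (b * (r * v2))\<^sup>2)
      = b\<^sup>2 * (2 * r * E - (r * v1)\<^sup>2 - (r * v2)\<^sup>2) - s\<^sup>2 * p\<^sup>2"
    by (simp add: power2_eq_square algebra_simps)
  ultimately have "(b * (r * v1) + s * p)\<^sup>2 + (b * (r * v2))\<^sup>2 < 2 * (b * r) * (b * E + s * p * v1)"
    using s2 by simp
  then have "(b * r, (b * (r * v1) + s * p, b * (r * v2)), b * E + s * p * v1) \<in> euler_G \<gamma>"
    using assms(1) pos b(2) by (simp add: euler_G_iff norm_mom)
  also have "(b * r, (b * (r * v1) + s * p, b * (r * v2)), b * E + s * p * v1) =
      a *\<^sub>R (U + (s / a) *\<^sub>R euler_flux1 \<gamma> U)"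
    using a unfolding euler_flux1_def Let_def p_def[symmetric] v1_def[symmetric] v2_def[symmetric]
      scaleR_right_distrib
    by (simp add: U b_def power2_eq_square algebra_simps)
  finally show "U + (s / a) *\<^sub>R euler_flux1 \<gamma> U \<in> euler_G \<gamma>"
    using scaleR_euler_G_iff[OF assms(1) a] by simp
qed

section \<open>Transfer to the second direction by exchanging the axes\<close>

definition swap_mom :: "euler_state \<Rightarrow> euler_state" where
  "swap_mom U = (dens U, (snd (mom U), fst (mom U)), energy U)"

lemma swap_mom_simps [simp]:
  "dens (swap_mom U) = dens U" "energy (swap_mom U) = energy U"
  "mom (swap_mom U) = (snd (mom U), fst (mom U))" "swap_mom (swap_mom U) = U"
  "pressure \<gamma> (swap_mom U) = pressure \<gamma> U" "swap_mom U \<in> euler_G \<gamma> \<longleftrightarrow> U \<in> euler_G \<gamma>"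
  "sound_speed \<gamma> (swap_mom U) = sound_speed \<gamma> U"
  "fst (velocity (swap_mom U)) = snd (velocity U)"
  by (simp_all add: swap_mom_def pressure_def norm_mom add.commute euler_G_def sound_speed_def
      velocity_def)

lemma bounded_linear_swap_mom: "bounded_linear swap_mom"
  unfolding swap_mom_def
  by (intro bounded_linear_Pair bounded_linear_intros)

text \<open>Symmetry of the Euler equations under reflection in the diagonal; it carries the results
  for the first flux over to the second.\<close>

lemma euler_flux2_eq_swap_mom: "euler_flux2 \<gamma> U = swap_mom (euler_flux1 \<gamma> (swap_mom U))"
  by (simp add: euler_flux1_def euler_flux2_def Let_def swap_mom_def velocity_def pressure_def
      norm_mom add.commute mult_ac)

lemma swap_mom_linear:
  "swap_mom (U + W) = swap_mom U + swap_mom W" "swap_mom (c *\<^sub>R U) = c *\<^sub>R swap_mom U"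
  by (simp_all add: swap_mom_def)

text \<open>Conjugation by \<open>swap_mom\<close> keeps eigenvalues and maps the acoustic
  eigenvector \<open>R\<close> at the reflected state to \<open>swap_mom R\<close>.\<close>

lemma euler_flux2_wave_speed_ge:
  assumes "1 < \<gamma>" "U \<in> euler_G \<gamma>"
  shows "\<bar>snd (velocity U)\<bar> + sound_speed \<gamma> U \<le> wave_speed (euler_flux2 \<gamma>) U"
proof -
  define s where "s = (if 0 \<le> snd (velocity U) then 1 else -1 :: real)"
  obtain D R where D: "(euler_flux1 \<gamma> has_derivative D) (at (swap_mom U))" "R \<noteq> 0"
    "D R = (fst (velocity (swap_mom U)) + s * sound_speed \<gamma> (swap_mom U)) *\<^sub>R R"
    using assms by (elim euler_flux1_eigenvector[of \<gamma> "swap_mom U" s]) (auto simp: s_def)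
  have "((\<lambda>U. swap_mom (euler_flux1 \<gamma> (swap_mom U))) has_derivative
      (\<lambda>h. swap_mom (D (swap_mom h)))) (at U)"
    by (intro bounded_linear.has_derivative[OF bounded_linear_swap_mom]
        has_derivative_compose[OF bounded_linear.has_derivative[OF bounded_linear_swap_mom
            has_derivative_ident] D(1)])
  then have "(euler_flux2 \<gamma> has_derivative (\<lambda>h. swap_mom (D (swap_mom h)))) (at U)"
    by (simp add: euler_flux2_eq_swap_mom[abs_def])
  moreover have "swap_mom R \<noteq> 0"
    using D(2) by (auto simp: swap_mom_def prod_eq_iff)
  moreover have "swap_mom (D (swap_mom (swap_mom R))) =
      (snd (velocity U) + s * sound_speed \<gamma> U) *\<^sub>R swap_mom R"
    using D(3) by (simp add: swap_mom_linear)
  ultimately have "\<bar>snd (velocity U) + s * sound_speed \<gamma> U\<bar> \<le> wave_speed (euler_flux2 \<gamma>) U"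
    by (rule abs_eigenvalue_le_wave_speed)
  moreover have "0 \<le> sound_speed \<gamma> U"
    using assms by (auto simp: sound_speed_def euler_G_def)
  then have "\<bar>snd (velocity U)\<bar> + sound_speed \<gamma> U = \<bar>snd (velocity U) + s * sound_speed \<gamma> U\<bar>"
    by (auto simp: s_def)
  ultimately show ?thesis by simp
qed

lemma euler_flux2_shift_in_G:
  assumes "1 < \<gamma>" "U \<in> euler_G \<gamma>" "\<bar>s\<bar> = 1" "\<bar>snd (velocity U)\<bar> + sound_speed \<gamma> U \<le> a"
  shows "0 < a" "U + (s / a) *\<^sub>R euler_flux2 \<gamma> U \<in> euler_G \<gamma>"
proof -
  have *: "swap_mom U \<in> euler_G \<gamma>" "\<bar>fst (velocity (swap_mom U))\<bar> + sound_speed \<gamma> (swap_mom U) \<le> a"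
    using assms by simp_all
  show "0 < a"
    by (rule euler_flux1_shift_in_G(1)[OF assms(1) *(1) assms(3) *(2)])
  have "swap_mom (swap_mom U + (s / a) *\<^sub>R euler_flux1 \<gamma> (swap_mom U)) \<in> euler_G \<gamma>"
    using euler_flux1_shift_in_G(2)[OF assms(1) *(1) assms(3) *(2)] by simp
  then show "U + (s / a) *\<^sub>R euler_flux2 \<gamma> U \<in> euler_G \<gamma>"
    by (simp add: swap_mom_linear euler_flux2_eq_swap_mom)
qed

section \<open>Lax-Friedrichs states for the Euler fluxes\<close>

lemma mid_in_convex:
  assumes "convex G"
    and shift: "\<And>U s a. U \<in> G \<Longrightarrow> \<bar>s\<bar> = 1 \<Longrightarrow> wave_speed F U \<le> a \<Longrightarrow> U + (s / a) *\<^sub>R F U \<in> G"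
    and "V \<in> G" "W \<in> G"
  shows "mid F V W \<in> G"
proof -
  let ?a = "alpha F V W"
  \<comment> \<open>\<open>alpha\<close> dominates both wave speeds, so the same coefficient is
    allowed in the shift of \<open>V\<close> with \<open>s = 1\<close> and in that of
    \<open>W\<close> with \<open>s = -1\<close>.\<close>
  have "V + (1 / ?a) *\<^sub>R F V \<in> G" "W + (- 1 / ?a) *\<^sub>R F W \<in> G"
    by (intro shift assms(3,4); simp add: alpha_def)+
  then have "(1/2) *\<^sub>R (V + (1 / ?a) *\<^sub>R F V) + (1/2) *\<^sub>R (W + (- 1 / ?a) *\<^sub>R F W) \<in> G"
    by (intro convexD[OF assms(1)]) simp_all
  also have "(1/2) *\<^sub>R (V + (1 / ?a) *\<^sub>R F V) + (1/2) *\<^sub>R (W + (- 1 / ?a) *\<^sub>R F W) = mid F V W"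
    by (simp add: mid_def algebra_simps)
  finally show ?thesis .
qed

text \<open>The sound speed is strictly positive, so the degenerate case never occurs.\<close>

lemma euler_alpha_pos:
  assumes "1 < \<gamma>" "F \<in> {euler_flux1 \<gamma>, euler_flux2 \<gamma>}" "V \<in> euler_G \<gamma>"
  shows "0 < alpha F V W"
proof -
  have "0 < sound_speed \<gamma> V"
    using assms by (simp add: sound_speed_def euler_G_def)
  then have "0 < wave_speed F V"
    using euler_flux1_wave_speed_ge[OF assms(1,3)] euler_flux2_wave_speed_ge[OF assms(1,3)] assms(2)
    by auto
  then show ?thesis by (simp add: alpha_def)
qed

lemma euler_mid_in_G:
  assumes "1 < \<gamma>" "F \<in> {euler_flux1 \<gamma>, euler_flux2 \<gamma>}" "V \<in> euler_G \<gamma>" "W \<in> euler_G \<gamma>"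
  shows "mid F V W \<in> euler_G \<gamma>"
proof (rule mid_in_convex[OF convex_euler_G[OF assms(1)] _ assms(3,4)])
  fix U s a assume U: "U \<in> euler_G \<gamma>" and s: "\<bar>s\<bar> = (1::real)" and a: "wave_speed F U \<le> a"
  show "U + (s / a) *\<^sub>R F U \<in> euler_G \<gamma>"
  proof (cases "F = euler_flux1 \<gamma>")
    case True
    show ?thesis
      using euler_flux1_wave_speed_ge[OF assms(1) U] a unfolding True
      by (intro euler_flux1_shift_in_G(2)[OF assms(1) U s]) linarith
  next
    case False
    with assms(2) have F: "F = euler_flux2 \<gamma>" by simp
    show ?thesis
      using euler_flux2_wave_speed_ge[OF assms(1) U] a unfolding F
      by (intro euler_flux2_shift_in_G(2)[OF assms(1) U s]) linarith
  qed
qed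

lemma euler_llf_admissible:
  assumes "1 < \<gamma>" "F \<in> {euler_flux1 \<gamma>, euler_flux2 \<gamma>}"
  shows "llf_admissible (euler_G \<gamma>) F"
  unfolding llf_admissible_def
proof (intro ballI)
  fix V W assume VW: "V \<in> euler_G \<gamma>" "W \<in> euler_G \<gamma>"
  show "0 \<le> alpha F V W \<and> mid F V W \<in> euler_G \<gamma> \<and> (alpha F V W = 0 \<longrightarrow> F V = F W)"
    using euler_alpha_pos[OF assms VW(1), of W] euler_mid_in_G[OF assms VW] by simp
qed

section \<open>Flux limiter for the Euler equations\<close>

text \<open>
  Multiplied by \<open>a\<^sup>2\<close>, the quantity \<open>\<rho> E - |m|\<^sup>2 / 2 - \<epsilon> \<rho>\<close> at the state
  \<open>S + (t / a) *\<^sub>R D\<close> is \<open>C + t * B - t\<^sup>2 * A\<close>; the choice of \<open>\<theta>\<close> makes it nonnegative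
  for \<open>t = \<plusminus>\<theta>\<close>.
\<close>

lemma euler_shift_in_G:
  assumes g: "1 < \<gamma>" and e: "0 < \<epsilon>" and a: "0 < a"
    and D: "\<bar>dens D\<bar> \<le> a * (dens S - \<epsilon>)" and t: "\<bar>t\<bar> \<le> 1"
    and A: "A = (norm (mom D))\<^sup>2 / 2 - dens D * energy D"
    and B: "B = a * (dens D * energy S + dens S * energy D - mom D \<bullet> mom S - \<epsilon> * dens D)"
    and C: "C = a\<^sup>2 * (dens S * energy S - (norm (mom S))\<^sup>2 / 2 - \<epsilon> * dens S)"
    and le: "\<bar>t\<bar> * (max 0 A + \<bar>B\<bar>) \<le> C"
  shows "S + (t / a) *\<^sub>R D \<in> euler_G \<gamma>"
proof -
  let ?r = "a * dens S + t * dens D" and ?E = "a * energy S + t * energy D"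
    and ?m = "a *\<^sub>R mom S + t *\<^sub>R mom D"
  have "\<bar>t * dens D\<bar> \<le> \<bar>dens D\<bar>"
    using t by (simp add: abs_mult mult_left_le_one_le)
  then have "a * \<epsilon> \<le> ?r"
    using D by (simp add: right_diff_distrib)
  then have r: "0 < ?r"
    using mult_pos_pos[OF a e] by linarith
  have "?r * ?E - (norm ?m)\<^sup>2 / 2 - a * \<epsilon> * ?r = C + t * B - t\<^sup>2 * A"
    unfolding A B C power2_norm_eq_inner
    by (simp add: inner_add_left inner_add_right inner_commute[of "mom S" "mom D"]
        power2_eq_square algebra_simps)
  \<comment> \<open>Because \<open>|t| \<le> 1\<close>, the square can be replaced by
    \<open>|t|\<close>: the condition on \<open>t\<close> becomes linear, and a quotient solves it
    instead of a root of a quadratic.\<close>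
  moreover have "t\<^sup>2 * A \<le> \<bar>t\<bar> * max 0 A"
  proof -
    have "t\<^sup>2 * A \<le> t\<^sup>2 * max 0 A"
      by (intro mult_left_mono) auto
    moreover have "t\<^sup>2 \<le> \<bar>t\<bar>"
      using mult_left_mono[OF t abs_ge_zero[of t]] by (simp add: power2_eq_square)
    then have "t\<^sup>2 * max 0 A \<le> \<bar>t\<bar> * max 0 A"
      by (rule mult_right_mono) simp
    ultimately show ?thesis by (rule order_trans)
  qed
  moreover have "- (t * B) \<le> \<bar>t\<bar> * \<bar>B\<bar>"
    unfolding abs_mult[symmetric] by (rule abs_ge_minus_self)
  ultimately have "(norm ?m)\<^sup>2 / 2 + a * \<epsilon> * ?r \<le> ?r * ?E"
    using le unfolding distrib_left by linarith
  \<comment> \<open>The positive threshold turns the weak inequality into a strict one.\<close>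
  moreover have "0 < a * \<epsilon> * ?r"
    using a e r by simp
  ultimately have "(norm ?m)\<^sup>2 < 2 * ?r * ?E" by linarith
  then have "(?r, ?m, ?E) \<in> euler_G \<gamma>"
    using g r by (simp add: euler_G_iff)
  also have "(?r, ?m, ?E) = a *\<^sub>R (S + (t / a) *\<^sub>R D)"
    using a by (simp add: prod_eq_iff distrib_left scaleR_right_distrib)
  finally show ?thesis
    using scaleR_euler_G_iff[OF g a] by simp
qed

text \<open>By \<open>small\<close>, a zero density correction is within the clip and
  \<open>C \<ge> 0\<close>. The condition in \<open>euler_shift_in_G\<close> involves only
  \<open>|t|\<close>, so one factor serves both signs of the shift.\<close>

lemma euler_flux_lim_split:
  assumes g: "1 < \<gamma>" and e: "0 < \<epsilon>" and F: "F \<in> {euler_flux1 \<gamma>, euler_flux2 \<gamma>}"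
    and w: "\<And>k. w k \<in> euler_G \<gamma>"
    and small: "\<epsilon> \<le> dens (mid F (w k) (w (k+1)))"
      "\<epsilon> \<le> pressure \<gamma> (mid F (w k) (w (k+1))) / (\<gamma> - 1)"
  shows "split_flux (euler_G \<gamma>) F (alpha F (w k) (w (k+1))) (w k) (w (k+1))
    (euler_flux_lim \<epsilon> F w FH k)"
proof -
  define a where "a = alpha F (w k) (w (k+1))"
  define S where "S = mid F (w k) (w (k+1))"
  define FL where "FL = llf F (w k) (w (k+1))"
  define d where "d = dens (FH - FL)"
  define dr where "dr = (if d \<ge> 0 then min d (a * (dens S - \<epsilon>)) else max d (a * (\<epsilon> - dens S)))"
  define D where "D = (dens FL + dr, mom FH, energy FH) - FL"
  define A where "A = (norm (mom D))\<^sup>2 / 2 - dens D * energy D"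
  define B where "B = a * (dens D * energy S + dens S * energy D - mom D \<bullet> mom S - \<epsilon> * dens D)"
  define C where "C = a\<^sup>2 * (dens S * energy S - (norm (mom S))\<^sup>2 / 2 - \<epsilon> * dens S)"
  define N where "N = max 0 A + \<bar>B\<bar>"
  define t where "t = (if N = 0 then 1 else min 1 (C / N))"
  have lim: "euler_flux_lim \<epsilon> F w FH k = FL + t *\<^sub>R D"
    unfolding euler_flux_lim_def Let_def t_def N_def C_def B_def A_def D_def dr_def d_def FL_def
      S_def a_def ..
  have a: "0 < a"
    unfolding a_def by (rule euler_alpha_pos[OF g F w])
  have sm: "\<epsilon> \<le> dens S" "\<epsilon> \<le> pressure \<gamma> S / (\<gamma> - 1)"
    using small by (simp_all add: S_def)
  have "0 \<le> a * (dens S - \<epsilon>)"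
    using a sm by simp
  moreover have "a * (\<epsilon> - dens S) = - (a * (dens S - \<epsilon>))"
    by (simp add: algebra_simps)
  ultimately have "\<bar>dr\<bar> \<le> a * (dens S - \<epsilon>)"
    by (auto simp: dr_def)
  then have D: "\<bar>dens D\<bar> \<le> a * (dens S - \<epsilon>)"
    by (simp add: D_def)
  have "C = a\<^sup>2 * (dens S * (pressure \<gamma> S / (\<gamma> - 1) - \<epsilon>))"
    using g e sm(1) by (simp add: C_def pressure_def field_simps)
  then have C: "0 \<le> C"
    using sm e by simp
  have N: "0 \<le> N" by (simp add: N_def)
  \<comment> \<open>If \<open>N = 0\<close>, the default value 1 is right, because then
    \<open>t * N = 0 \<le> C\<close>.\<close>
  have t: "0 \<le> t" "t \<le> 1" "t * N \<le> C"
    using N C by (auto simp: t_def min_def field_simps)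
  have "S + (s / a) *\<^sub>R D \<in> euler_G \<gamma>" if "\<bar>s\<bar> = t" for s
    using t that unfolding N_def by (intro euler_shift_in_G[OF g e a D _ A_def B_def C_def]) auto
  from this[of t] this[of "- t"] have "S + (1 / a) *\<^sub>R (t *\<^sub>R D) \<in> euler_G \<gamma>"
    "S - (1 / a) *\<^sub>R (t *\<^sub>R D) \<in> euler_G \<gamma>"
    using t(1) by simp_all
  then show ?thesis
    unfolding lim FL_def using a
    by (intro split_flux_corrected_llf euler_llf_admissible[OF g F] w) (simp_all add: a_def S_def)
qed

section \<open>Point-value limiter and full stage for the Euler equations\<close>

lemma blend_factor_bounds:
  assumes "\<epsilon> \<le> qL"
  shows "0 \<le> blend_factor \<epsilon> qL qH" "blend_factor \<epsilon> qL qH \<le> 1"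
    "\<epsilon> \<le> blend_factor \<epsilon> qL qH * qH + (1 - blend_factor \<epsilon> qL qH) * qL"
proof -
  let ?t = "blend_factor \<epsilon> qL qH"
  show "0 \<le> ?t" "?t \<le> 1"
    using assms by (auto simp: blend_factor_def)
  \<comment> \<open>The blend equals \<open>qL - t * (qL - qH)\<close>, so this inequality says that
    it is at least \<open>\<epsilon>\<close>.\<close>
  have "?t * (qL - qH) \<le> qL - \<epsilon>" if "qH < qL"
  proof -
    have "?t \<le> (qL - \<epsilon>) / (qL - qH)"
      using that by (simp add: blend_factor_def)
    then show ?thesis
      using that by (simp add: pos_le_divide_eq)
  qed
  moreover have "\<not> qH < qL \<Longrightarrow> ?t = 1"
    by (simp add: blend_factor_def)
  ultimately show "\<epsilon> \<le> ?t * qH + (1 - ?t) * qL"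
    using assms by (cases "qH < qL") (auto simp: algebra_simps)
qed

text \<open>The second factor is computed as if the pressure were linear between the two states. By
  concavity the true pressure is at least this interpolation; this applies because the first step
  keeps the density of \<open>Us\<close> at or above \<open>\<epsilon>\<close>.\<close>

lemma euler_pv_lim_in_G:
  assumes g: "1 < \<gamma>" and e: "0 < \<epsilon>" and UL: "\<epsilon> \<le> dens UL" "\<epsilon> \<le> pressure \<gamma> UL"
  shows "euler_pv_lim \<gamma> \<epsilon> UL UH \<in> euler_G \<gamma>"
proof -
  define t1 where "t1 = blend_factor \<epsilon> (dens UL) (dens UH)"
  define Us where "Us = (t1 * dens UH + (1 - t1) * dens UL, mom UH, energy UH)"
  define t2 where "t2 = blend_factor \<epsilon> (pressure \<gamma> UL) (pressure \<gamma> Us)"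
  have lim: "euler_pv_lim \<gamma> \<epsilon> UL UH = t2 *\<^sub>R Us + (1 - t2) *\<^sub>R UL"
    unfolding euler_pv_lim_def Let_def t2_def Us_def t1_def ..
  have Us: "\<epsilon> \<le> dens Us"
    using blend_factor_bounds(3)[OF UL(1)] by (simp add: Us_def t1_def)
  have t2: "0 \<le> t2" "t2 \<le> 1" "\<epsilon> \<le> t2 * pressure \<gamma> Us + (1 - t2) * pressure \<gamma> UL"
    using blend_factor_bounds[OF UL(2)] by (simp_all add: t2_def)
  note t2(3)
  also have "t2 * pressure \<gamma> Us + (1 - t2) * pressure \<gamma> UL \<le>
      pressure \<gamma> (t2 *\<^sub>R Us + (1 - t2) *\<^sub>R UL)"
    using g e UL(1) Us t2 by (intro pressure_concave) auto
  finally have p: "0 < pressure \<gamma> (t2 *\<^sub>R Us + (1 - t2) *\<^sub>R UL)"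
    using e by linarith
  have "t2 * \<epsilon> + (1 - t2) * \<epsilon> \<le> t2 * dens Us + (1 - t2) * dens UL"
    using t2 Us UL by (intro add_mono mult_left_mono) auto
  then have "0 < dens (t2 *\<^sub>R Us + (1 - t2) *\<^sub>R UL)"
    using e by (simp add: algebra_simps)
  with p show ?thesis
    unfolding lim by (simp add: euler_G_def)
qed

text \<open>\<open>small_threshold\<close> speaks only of low-order states in the admissible set.
  For cells this membership is \<open>euler_mid_in_G\<close>; for points it is the premise in the
  limiter condition of \<open>limited_stage_dofs_in\<close>.\<close>

lemma euler_stage_dofs_in:
  assumes xy: "strict_mono x" "strict_mono y" and dt: "0 < dt"
    and g: "1 < \<gamma>" and e: "0 < \<epsilon>"
    and W: "dofs_in (euler_G \<gamma>) W"
    and cfl: "cfl_avg x y (euler_flux1 \<gamma>) (euler_flux2 \<gamma>) dt W"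
      "cfl_pv x y (euler_flux1 \<gamma>) (euler_flux2 \<gamma>) dt W"
    and small: "small_threshold \<gamma> \<epsilon> x y dt W"
  shows "dofs_in (euler_G \<gamma>) (euler_stage \<gamma> \<epsilon> x y FH1 FH2 R dt W)"
  unfolding euler_stage_def
proof (rule limited_stage_dofs_in[OF xy dt convex_euler_G[OF g] _ _ W cfl])
  show adm: "llf_admissible (euler_G \<gamma>) (euler_flux1 \<gamma>)" "llf_admissible (euler_G \<gamma>) (euler_flux2 \<gamma>)"
    by (rule euler_llf_admissible[OF g]; simp)+
  have avg: "avg W i j \<in> euler_G \<gamma>" for i j
    using W by (simp add: dofs_in_def)
  have m1: "mid (euler_flux1 \<gamma>) (avg W i j) (avg W (i+1) j) \<in> euler_G \<gamma>" for i j
    by (rule euler_mid_in_G[OF g _ avg avg]) simp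
  have m2: "mid (euler_flux2 \<gamma>) (avg W i j) (avg W i (j+1)) \<in> euler_G \<gamma>" for i j
    by (rule euler_mid_in_G[OF g _ avg avg]) simp
  note s = small[unfolded small_threshold_def Let_def]
  show "split_flux (euler_G \<gamma>) (euler_flux1 \<gamma>)
      (alpha (euler_flux1 \<gamma>) (avg W i j) (avg W (i+1) j)) (avg W i j) (avg W (i+1) j)
      (euler_flux_lim \<epsilon> (euler_flux1 \<gamma>) (\<lambda>k. avg W k j) (FH1 W i j) i)" for i j
    using s m1[of i j] by (intro euler_flux_lim_split[OF g e, where w = "\<lambda>k. avg W k j"] avg) auto
  show "split_flux (euler_G \<gamma>) (euler_flux2 \<gamma>)
      (alpha (euler_flux2 \<gamma>) (avg W i j) (avg W i (j+1))) (avg W i j) (avg W i (j+1))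
      (euler_flux_lim \<epsilon> (euler_flux2 \<gamma>) (\<lambda>k. avg W i k) (FH2 W i j) j)" for i j
    using s m2[of i j] by (intro euler_flux_lim_split[OF g e, where w = "\<lambda>k. avg W i k"] avg) auto
  show "euler_pv_lim \<gamma> \<epsilon> (pv_low x y (euler_flux1 \<gamma>) (euler_flux2 \<gamma>) dt W \<sigma>) UH \<in> euler_G \<gamma>"
    if "pv_low x y (euler_flux1 \<gamma>) (euler_flux2 \<gamma>) dt W \<sigma> \<in> euler_G \<gamma>" for \<sigma> UH
    using s that by (intro euler_pv_lim_in_G[OF g e]) blast+
qed

text \<open>Both parts are instances of \<open>ssp_rk3_iterate_dofs_in\<close>. Conditions are
  imposed at the three start states of every step, since the wave speeds are evaluated
  there.\<close>

theorem proposition4p1: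
  fixes x y :: "int \<Rightarrow> real" and dt :: "nat \<Rightarrow> real"
  assumes "strict_mono x" and "strict_mono y" and "\<And>n. dt n > 0"
  shows
    "(\<forall>(f1 :: real \<Rightarrow> real) f2 fH1 fH2 R b (u0 :: real \<times> real \<Rightarrow> real) m0 M0
        (u :: nat \<Rightarrow> real af) (N :: nat).
       let S = scalar_stage b m0 M0 x y f1 f2 fH1 fH2 R in
       m0 \<in> u0 ` mesh_domain x y \<longrightarrow> M0 \<in> u0 ` mesh_domain x y \<longrightarrow>
       (\<forall>z\<in>mesh_domain x y. m0 \<le> u0 z \<and> u0 z \<le> M0) \<longrightarrow>
       admissible_flux {m0..M0} f1 \<longrightarrow> admissible_flux {m0..M0} f2 \<longrightarrow>
       (\<forall>n<N. u (Suc n) = ssp_rk3 (S (dt n)) (u n)) \<longrightarrow>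
       dofs_in {m0..M0} (u 0) \<longrightarrow>
       (\<forall>n<N. \<forall>w \<in> rk_stages (S (dt n)) (u n).
          cfl_avg x y f1 f2 (dt n) w \<and> cfl_pv x y f1 f2 (dt n) w) \<longrightarrow>
       (\<forall>n\<le>N. dofs_in {m0..M0} (u n)))
     \<and>
     (\<forall>\<gamma> \<epsilon> FH1 FH2 R (U :: nat \<Rightarrow> euler_state af) (N :: nat).
       let S = euler_stage \<gamma> \<epsilon> x y FH1 FH2 R in
       \<gamma> > 1 \<longrightarrow> \<epsilon> > 0 \<longrightarrow>
       (\<forall>n<N. U (Suc n) = ssp_rk3 (S (dt n)) (U n)) \<longrightarrow>
       dofs_in (euler_G \<gamma>) (U 0) \<longrightarrow>
       (\<forall>n<N. \<forall>W \<in> rk_stages (S (dt n)) (U n).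
          cfl_avg x y (euler_flux1 \<gamma>) (euler_flux2 \<gamma>) (dt n) W \<and>
          cfl_pv x y (euler_flux1 \<gamma>) (euler_flux2 \<gamma>) (dt n) W \<and>
          small_threshold \<gamma> \<epsilon> x y (dt n) W) \<longrightarrow>
       (\<forall>n\<le>N. dofs_in (euler_G \<gamma>) (U n)))"
proof (intro conjI allI)
  fix f1 f2 :: "real \<Rightarrow> real" and fH1 fH2 R b and u0 :: "real \<times> real \<Rightarrow> real" and m0 M0
    and u :: "nat \<Rightarrow> real af" and N :: nat
  show "let S = scalar_stage b m0 M0 x y f1 f2 fH1 fH2 R in
       m0 \<in> u0 ` mesh_domain x y \<longrightarrow> M0 \<in> u0 ` mesh_domain x y \<longrightarrow>
       (\<forall>z\<in>mesh_domain x y. m0 \<le> u0 z \<and> u0 z \<le> M0) \<longrightarrow>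
       admissible_flux {m0..M0} f1 \<longrightarrow> admissible_flux {m0..M0} f2 \<longrightarrow>
       (\<forall>n<N. u (Suc n) = ssp_rk3 (S (dt n)) (u n)) \<longrightarrow>
       dofs_in {m0..M0} (u 0) \<longrightarrow>
       (\<forall>n<N. \<forall>w \<in> rk_stages (S (dt n)) (u n).
          cfl_avg x y f1 f2 (dt n) w \<and> cfl_pv x y f1 f2 (dt n) w) \<longrightarrow>
       (\<forall>n\<le>N. dofs_in {m0..M0} (u n))"
    unfolding Let_def
  proof (intro impI allI)
    let ?S = "scalar_stage b m0 M0 x y f1 f2 fH1 fH2 R" and ?G = "{m0..M0}"
    assume f: "admissible_flux ?G f1" "admissible_flux ?G f2"
      and step: "\<forall>n<N. u (Suc n) = ssp_rk3 (?S (dt n)) (u n)" and init: "dofs_in ?G (u 0)"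
      and cfl: "\<forall>n<N. \<forall>w \<in> rk_stages (?S (dt n)) (u n).
          cfl_avg x y f1 f2 (dt n) w \<and> cfl_pv x y f1 f2 (dt n) w"
    show "dofs_in ?G (u n)" if "n \<le> N" for n
    proof (rule ssp_rk3_iterate_dofs_in[where u = u and S = "\<lambda>n. ?S (dt n)", OF _ init _ _ that])
      show "convex ?G" by (rule convex_real_interval)
      show "u (Suc n) = ssp_rk3 (?S (dt n)) (u n)" if "n < N" for n
        using step that by blast
      show "dofs_in ?G (?S (dt n) w)"
        if "n < N" "w \<in> rk_stages (?S (dt n)) (u n)" "dofs_in ?G w" for n w
        using cfl that(1,2) by (intro scalar_stage_dofs_in[OF assms f that(3)]) auto
    qed
  qed
next
  fix \<gamma> \<epsilon> FH1 FH2 R and U :: "nat \<Rightarrow> euler_state af" and N :: nat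
  show "let S = euler_stage \<gamma> \<epsilon> x y FH1 FH2 R in
       \<gamma> > 1 \<longrightarrow> \<epsilon> > 0 \<longrightarrow>
       (\<forall>n<N. U (Suc n) = ssp_rk3 (S (dt n)) (U n)) \<longrightarrow>
       dofs_in (euler_G \<gamma>) (U 0) \<longrightarrow>
       (\<forall>n<N. \<forall>W \<in> rk_stages (S (dt n)) (U n).
          cfl_avg x y (euler_flux1 \<gamma>) (euler_flux2 \<gamma>) (dt n) W \<and>
          cfl_pv x y (euler_flux1 \<gamma>) (euler_flux2 \<gamma>) (dt n) W \<and>
          small_threshold \<gamma> \<epsilon> x y (dt n) W) \<longrightarrow>
       (\<forall>n\<le>N. dofs_in (euler_G \<gamma>) (U n))"
    unfolding Let_def
  proof (intro impI allI)
    let ?S = "euler_stage \<gamma> \<epsilon> x y FH1 FH2 R" and ?G = "euler_G \<gamma>"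
    assume g: "\<gamma> > 1" and e: "\<epsilon> > 0"
      and step: "\<forall>n<N. U (Suc n) = ssp_rk3 (?S (dt n)) (U n)" and init: "dofs_in ?G (U 0)"
      and cfl: "\<forall>n<N. \<forall>W \<in> rk_stages (?S (dt n)) (U n).
          cfl_avg x y (euler_flux1 \<gamma>) (euler_flux2 \<gamma>) (dt n) W \<and>
          cfl_pv x y (euler_flux1 \<gamma>) (euler_flux2 \<gamma>) (dt n) W \<and>
          small_threshold \<gamma> \<epsilon> x y (dt n) W"
    show "dofs_in ?G (U n)" if "n \<le> N" for n
    proof (rule ssp_rk3_iterate_dofs_in[where u = U and S = "\<lambda>n. ?S (dt n)", OF _ init _ _ that])
      show "convex ?G" by (rule convex_euler_G[OF g])
      show "U (Suc n) = ssp_rk3 (?S (dt n)) (U n)" if "n < N" for n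
        using step that by blast
      show "dofs_in ?G (?S (dt n) W)"
        if "n < N" "W \<in> rk_stages (?S (dt n)) (U n)" "dofs_in ?G W" for n W
        using cfl that(1,2) by (intro euler_stage_dofs_in[OF assms g e that(3)]) auto
    qed
  qed
qed

end
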